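(* Consider the switched system $\dot x(t)=f_{\sigma(t)}(x(t),v(t))$, $y(t)=h_{\sigma(t)}(x(t))$, $x(0)=x_0$, $t\ge 0$, generated by a finite family of subsystems indexed by $\mathcal P=\mathcal P_S\sqcup\mathcal P_U$, with set of admissible switches $E(\mathcal P)$ and admissible minimum and maximum dwell times $0<\delta\le\Delta$ (see context). Suppose that: (A1) There exist class $\mathcal K_\infty$ functions $\underline\alpha,\overline\alpha,\gamma_1,\gamma_2$, continuously differentiable functions $V_p:\mathbb R^d\to[0,+\infty[$, $p\in\mathcal P$, and constants $\lambda_s,\lambda_u>0$ such that for all $\xi\in\mathbb R^d$ and $\eta\in\mathbb R^m$: $\underline\alpha(\|\xi\|)\le V_p(\xi)\le\overline\alpha(\|\xi\|)$ for all $p\in\mathcal P$; $\frac{\partial V_p}{\partial\xi}(\xi)f_p(\xi,\eta)\le-\lambda_sV_p(\xi)+\gamma_1(\|\eta\|)+\gamma_2(\|h_p(\xi)\|)$ for all $p\in\mathcal P_S$; $\frac{\partial V_p}{\partial\xi}(\xi)f_p(\xi,\eta)\le\lambda_uV_p(\xi)+\gamma_1(\|\eta\|)+\gamma_2(\|h_p(\xi)\|)$ for all $p\in\mathcal P_U$. (A2) There exists $\mu\ge1$ such that $V_q(\xi)\le\mu V_p(\xi)$ for all $\xi\in\mathbb R^d$ and all $(p,q)\in E(\mathcal P)$. (A3) For every $p\in\mathcal P_U$ there exists $q\in\mathcal P_S$ such that $(p,q)\in E(\mathcal P)$. (A4) There exist scalars $\check\delta,\hat\Delta\in[\delta,\Delta]$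 such that $-\lambda_s\frac{\check\delta}{\Delta}+\lambda_s\frac{\check\delta}{2\delta}+\lambda_u\frac{\hat\Delta}{2\delta}+(\ln\mu)\frac1\delta<0$. Let $\lambda_s^*,\lambda_u^*$ satisfy $$\lambda_s^*\in\,]0,\lambda_s[,\quad \lambda_u^*\ge\lambda_u,\quad \lambda_s-\lambda_s^*+\lambda_u-\lambda_u^*\ge0,$$ $$-\lambda_s^*\frac{\check\delta}{\Delta}+\lambda_s^*\frac{\check\delta}{2\delta}+\lambda_u^*\frac{\hat\Delta}{2\delta}<0,$$ $$(\ln\mu)\frac1\delta-(\lambda_s-\lambda_s^* )+(\lambda_s-\lambda_s^*+\lambda_u-\lambda_u^* )\frac{\hat\Delta}{2\delta}<0,$$ and let $\tilde\delta,\tilde\Delta>0$ satisfy $$\tilde\delta\le\check\delta,\quad\tilde\Delta\ge\hat\Delta,\quad -\lambda_s^*+(\lambda_s^*+\lambda_u^* )\frac{\tilde\Delta}{\tilde\delta+\tilde\Delta}<0,\quad \frac{\tilde\Delta\hat\Delta}{2\delta}+\frac{\tilde\delta\hat\Delta}{2\delta}-\tilde\Delta\le0 .$$ Consider the scalar switched system $$\dot z(t)=g_{\zeta(t)}(z(t),v(t),y(t)),\quad z(0)=z_0\ge0,\quad t\ge0,$$ with $g_0(z,v,y)=-\lambda_s^*z+\gamma_1(\|v\|)+\gamma_2(\|y\|)$, $g_1(z,v,y)=\lambda_u^*z+\gamma_1(\|v\|)+\gamma_2(\|y\|)$, and $\zeta:[0,+\infty[\to\{0,1\}$ given for $k=0,1,2,\dots$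 by $\zeta(t)=0$ if $t\in\,]k(\tilde\delta+\tilde\Delta),k(\tilde\delta+\tilde\Delta)+\tilde\delta]$ and $\zeta(t)=1$ if $t\in\,]k(\tilde\delta+\tilde\Delta)+\tilde\delta,(k+1)(\tilde\delta+\tilde\Delta)]$. Let the switching signal $\sigma$ of the $x$-system belong to the set $\mathcal S'_{\mathcal R}$ defined in the context using these $\check\delta,\hat\Delta$. Then the $z$-system is a state-norm estimator for the switched system.
   Context: Setting. $\mathcal P=\{1,\dots,N\}$ is a finite index set, partitioned as $\mathcal P=\mathcal P_S\sqcup\mathcal P_U$ (indices of "stable", i.e. IOSS, and "unstable" subsystems). For each $p\in\mathcal P$, $f_p:\mathbb R^d\times\mathbb R^m\to\mathbb R^d$ is locally Lipschitz with $f_p(0,0)=0$, and $h_p:\mathbb R^d\to\mathbb R^k$ is continuous with $h_p(0)=0$. Inputs $v:[0,\infty[\to\mathbb R^m$ are Lebesgue measurable and essentially bounded. $\|\cdot\|$ is the Euclidean norm and, for an interval $I\subseteq[0,\infty[$, $\|\cdot\|_I$ is the essential supremum norm on $I$. A switching signal is a piecewise constant function $\sigma:[0,+\infty[\to\mathcal P$, right-continuous with left limits everywhere; its switching instants (points where it jumps) are $0=:\tau_0<\tau_1<\tau_2<\cdots$. Solutions are in the Carathéodory sense. $E(\mathcal P)$ is a given set of pairs $(p,q)$, $p,q\in\mathcal P$, $p\ne q$ (the allowed switches from $p$ to $q$). Admissible signals. $\mathcal S_{\mathcal R}$ is the set of switching signals such that $(\sigma(\tau_i),\sigma(\tau_{i+1}))\in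 E(\mathcal P)$ and $\tau_{i+1}-\tau_i\in[\delta,\Delta]$ for $i=0,1,2,\dots$. Given $\check\delta,\hat\Delta\in[\delta,\Delta]$, $\mathcal S'_{\mathcal R}$ is the set of all $\sigma\in\mathcal S_{\mathcal R}$ such that for all $i=0,1,2,\dots$: (C1) $\sigma(\tau_i)\in\mathcal P_U$ and $\sigma(\tau_{i+1})\in\mathcal P_U$ do not both hold; (C2) $\tau_{i+1}-\tau_i\in[\check\delta,\Delta]$ whenever $\sigma(\tau_i)\in\mathcal P_S$; (C3) $\tau_{i+1}-\tau_i\in[\delta,\hat\Delta]$ whenever $\sigma(\tau_i)\in\mathcal P_U$. State-norm estimator. A system with state $z$, driven by the input $v$ and output $y$ of the switched $x$-system, with initial states $z_0\ge 0$, is a state-norm estimator for the switched $x$-system if: (a) it is input-to-state stable (ISS) with respect to $(v,y)$: there exist class $\mathcal K_\infty$ functions $\alpha,\chi$ and a class $\mathcal{KL}$ function $\beta$ such that $\alpha(\|z(t)\|)\le\beta(\|z_0\|,t)+\chi(\|(v,y)\|_{[0,t]})$ for all $t\ge0$, all initial states $z_0$ and all inputs $(v,y)$; and (b) there exist a class $\mathcal{KL}$ function $\overline\beta$ and a class $\mathcal K_\infty$ function $\overline\chi$ such that for all initial states $x_0$ and $z_0$ and all inputs $v$, $\|x(t)\|\le\overline\beta(\|x_0\|+\|z_0\|,t)+\overline\chi(\|z(t)\|)$ for all $t\ge0$ (for which the solution $x$ is defined). The value $\zeta(0)$ is immaterial. *)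

theory Defs
  imports "HOL-Analysis.Analysis" "HOL-Probability.Essential_Supremum"
begin

section \<open>Comparison functions\<close>

definition class_K :: "(real \<Rightarrow> real) \<Rightarrow> bool" where
  "class_K \<alpha> \<longleftrightarrow> continuous_on {0..} \<alpha> \<and> strict_mono_on {0..} \<alpha> \<and> \<alpha> 0 = 0"

definition class_Kinf :: "(real \<Rightarrow> real) \<Rightarrow> bool" where
  "class_Kinf \<alpha> \<longleftrightarrow> class_K \<alpha> \<and> filterlim \<alpha> at_top at_top"

text \<open>Joint continuity is part of the definition; ``decreasing'' is meant in the weak sense,
  since \<open>\<beta> 0\<close> is identically zero.\<close>

definition class_KL :: "(real \<Rightarrow> real \<Rightarrow> real) \<Rightarrow> bool" where
  "class_KL \<beta> \<longleftrightarrow>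
     continuous_on ({0..} \<times> {0..}) (\<lambda>(r, t). \<beta> r t) \<and>
     (\<forall>t\<ge>0. class_K (\<lambda>r. \<beta> r t)) \<and>
     (\<forall>r\<ge>0. antimono_on {0..} (\<beta> r) \<and> (\<beta> r \<longlongrightarrow> 0) at_top)"

section \<open>Regularity of the data\<close>

definition locally_lipschitz :: "('a::metric_space \<Rightarrow> 'b::metric_space) \<Rightarrow> bool" where
  "locally_lipschitz F \<longleftrightarrow> (\<forall>x. \<exists>r>0. \<exists>L. L-lipschitz_on (cball x r) F)"

definition continuously_differentiable ::
    "('a::real_normed_vector \<Rightarrow> 'b::real_normed_vector) \<Rightarrow> bool" where
  "continuously_differentiable F \<longleftrightarrow>
     (\<exists>F' :: 'a \<Rightarrow> 'a \<Rightarrow>\<^sub>L 'b.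
        continuous_on UNIV F' \<and> (\<forall>x. (F has_derivative blinfun_apply (F' x)) (at x)))"

section \<open>Essential supremum norm and essentially bounded inputs\<close>

text \<open>\<open>esssup\<close> is infinite on non-measurable functions and \<open>enn2real\<close> sends infinity to 0, so
  \<open>ess_norm I u\<close> is the essential supremum norm only if \<open>ess_bounded I u\<close>.  On intervals of
  measure zero the norm is 0.\<close>

definition ess_bounded :: "real set \<Rightarrow> (real \<Rightarrow> 'a::euclidean_space) \<Rightarrow> bool" where
  "ess_bounded I u \<longleftrightarrow>
     u \<in> borel_measurable (lebesgue_on I) \<and>
     esssup (lebesgue_on I) (\<lambda>s. ennreal (norm (u s))) < \<infinity>"

definition ess_norm :: "real set \<Rightarrow> (real \<Rightarrow> 'a::euclidean_space) \<Rightarrow> real" where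
  "ess_norm I u = enn2real (esssup (lebesgue_on I) (\<lambda>s. ennreal (norm (u s))))"

section \<open>Solutions of ordinary differential equations\<close>

text \<open>\<open>x\<close> is a Caratheodory solution of \<open>x' = F t x\<close>, \<open>x 0 = x0\<close>, on \<open>[0,T[\<close>, with
  \<open>T = \<infinity>\<close> allowed. The Lebesgue integral equation expresses that \<open>x\<close> is locally absolutely
  continuous and satisfies the differential equation almost everywhere.\<close>

definition caratheodory_solution ::
    "ereal \<Rightarrow> (real \<Rightarrow> 'a::euclidean_space \<Rightarrow> 'a) \<Rightarrow> 'a \<Rightarrow> (real \<Rightarrow> 'a) \<Rightarrow> bool" where
  "caratheodory_solution T F x0 x \<longleftrightarrow>
     (\<forall>t\<ge>0. ereal t < T \<longrightarrow>
        set_integrable lebesgue {0..t} (\<lambda>s. F s (x s)) \<and>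
        x t = x0 + (LINT s:{0..t}|lebesgue. F s (x s)))"

section \<open>Switching signals\<close>

text \<open>\<open>\<sigma>\<close> is piecewise constant and right-continuous on \<open>[0,\<infinity>[\<close>; its points of discontinuity
  are exactly \<open>\<tau> 1 < \<tau> 2 < \<dots>\<close>, and \<open>\<tau> 0 = 0\<close>.\<close>

definition switching_instants :: "(real \<Rightarrow> 'p) \<Rightarrow> (nat \<Rightarrow> real) \<Rightarrow> bool" where
  "switching_instants \<sigma> \<tau> \<longleftrightarrow>
     \<tau> 0 = 0 \<and> strict_mono \<tau> \<and> filterlim \<tau> at_top sequentially \<and>
     (\<forall>i. \<forall>t\<in>{\<tau> i..<\<tau> (Suc i)}. \<sigma> t = \<sigma> (\<tau> i)) \<and>
     (\<forall>i. \<sigma> (\<tau> (Suc i)) \<noteq> \<sigma> (\<tau> i))"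

lemma switching_instants_unique:
  assumes "switching_instants \<sigma> \<tau>" "switching_instants \<sigma> \<tau>'"
  shows "\<tau> = \<tau>'"
proof
  have *: "\<tau>2 (Suc i) \<le> \<tau>1 (Suc i)"
    if "switching_instants \<sigma> \<tau>1" "switching_instants \<sigma> \<tau>2" "\<tau>1 i = \<tau>2 i"
    for \<tau>1 \<tau>2 :: "nat \<Rightarrow> real" and i
  proof (rule ccontr)
    assume "\<not> \<tau>2 (Suc i) \<le> \<tau>1 (Suc i)"
    moreover have "\<tau>1 i < \<tau>1 (Suc i)"
      using that(1) by (simp add: switching_instants_def strict_mono_Suc_iff)
    ultimately have "\<tau>1 (Suc i) \<in> {\<tau>2 i..<\<tau>2 (Suc i)}"
      using that(3) by auto
    then have "\<sigma> (\<tau>1 (Suc i)) = \<sigma> (\<tau>2 i)"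
      using that(2) unfolding switching_instants_def by blast
    then show False
      using that(1,3) unfolding switching_instants_def by metis
  qed
  show "\<tau> i = \<tau>' i" for i
  proof (induction i)
    case 0
    then show ?case using assms by (simp add: switching_instants_def)
  next
    case (Suc i)
    then show ?case using *[OF assms] *[OF assms(2,1)] by (simp add: antisym)
  qed
qed

definition admissible_signals ::
    "'p set \<Rightarrow> ('p \<times> 'p) set \<Rightarrow> real \<Rightarrow> real \<Rightarrow> (real \<Rightarrow> 'p) set" where
  "admissible_signals P E \<delta> \<Delta> =
     {\<sigma>. (\<forall>t\<ge>0. \<sigma> t \<in> P) \<and>
         (\<exists>\<tau>. switching_instants \<sigma> \<tau> \<and>
              (\<forall>i. (\<sigma> (\<tau> i), \<sigma> (\<tau> (Suc i))) \<in> E \<and> \<tau> (Suc i) - \<tau> i \<in> {\<delta>..\<Delta>}))}"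

text \<open>\<open>\<delta>s\<close> is the lower bound on the dwell time on stable subsystems and \<open>\<Delta>u\<close> the upper bound
  on the dwell time on unstable ones.\<close>

definition restricted_admissible_signals ::
    "'p set \<Rightarrow> 'p set \<Rightarrow> ('p \<times> 'p) set \<Rightarrow> real \<Rightarrow> real \<Rightarrow> real \<Rightarrow> real \<Rightarrow> (real \<Rightarrow> 'p) set" where
  "restricted_admissible_signals PS PU E \<delta> \<Delta> \<delta>s \<Delta>u =
     {\<sigma> \<in> admissible_signals (PS \<union> PU) E \<delta> \<Delta>.
        \<exists>\<tau>. switching_instants \<sigma> \<tau> \<and>
          (\<forall>i. \<not> (\<sigma> (\<tau> i) \<in> PU \<and> \<sigma> (\<tau> (Suc i)) \<in> PU) \<and>
               (\<sigma> (\<tau> i) \<in> PS \<longrightarrow> \<tau> (Suc i) - \<tau> i \<in> {\<delta>s..\<Delta>}) \<and>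
               (\<sigma> (\<tau> i) \<in> PU \<longrightarrow> \<tau> (Suc i) - \<tau> i \<in> {\<delta>..\<Delta>u}))}"

section \<open>State-norm estimators\<close>

text \<open>The estimator is the system \<open>z' = G t z (v t) (y t)\<close> with initial states in \<open>Z0\<close>, where
  \<open>G\<close> may depend on time.  Solutions of the switched system need not be global, so its output
  may exist on a bounded interval only; for this reason both parts of the definition deal with
  signals on \<open>[0,T[\<close> for \<open>0 < T \<le> \<infinity>\<close>.  Input-to-state stability includes that for all
  admissible inputs solutions exist on the whole of \<open>[0,T[\<close>.\<close>

definition iss_wrt_input_output ::
    "(real \<Rightarrow> 'z::euclidean_space \<Rightarrow> 'm::euclidean_space \<Rightarrow> 'k::euclidean_space \<Rightarrow> 'z) \<Rightarrow>
     'z set \<Rightarrow> bool" where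
  "iss_wrt_input_output G Z0 \<longleftrightarrow>
     (\<exists>\<alpha> \<rho> \<beta>. class_Kinf \<alpha> \<and> class_Kinf \<rho> \<and> class_KL \<beta> \<and>
        (\<forall>T>0. \<forall>z0\<in>Z0. \<forall>v y.
           (\<forall>t\<ge>0. ereal t < T \<longrightarrow> ess_bounded {0..t} (\<lambda>s. (v s, y s))) \<longrightarrow>
           (\<exists>z. caratheodory_solution T (\<lambda>s \<xi>. G s \<xi> (v s) (y s)) z0 z) \<and>
           (\<forall>z. caratheodory_solution T (\<lambda>s \<xi>. G s \<xi> (v s) (y s)) z0 z \<longrightarrow>
              (\<forall>t\<ge>0. ereal t < T \<longrightarrow>
                 \<alpha> (norm (z t)) \<le> \<beta> (norm z0) t + \<rho> (ess_norm {0..t} (\<lambda>s. (v s, y s)))))))"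

definition state_norm_estimator ::
    "('p \<Rightarrow> 'd::euclidean_space \<Rightarrow> 'm::euclidean_space \<Rightarrow> 'd) \<Rightarrow>
     ('p \<Rightarrow> 'd \<Rightarrow> 'k::euclidean_space) \<Rightarrow> (real \<Rightarrow> 'p) \<Rightarrow>
     (real \<Rightarrow> 'z::euclidean_space \<Rightarrow> 'm \<Rightarrow> 'k \<Rightarrow> 'z) \<Rightarrow> 'z set \<Rightarrow> bool" where
  "state_norm_estimator f h \<sigma> G Z0 \<longleftrightarrow>
     iss_wrt_input_output G Z0 \<and>
     (\<exists>\<beta> \<rho>. class_KL \<beta> \<and> class_Kinf \<rho> \<and>
        (\<forall>x0. \<forall>z0\<in>Z0. \<forall>v. ess_bounded {0..} v \<longrightarrow>
           (\<forall>T>0. \<forall>x z.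
              caratheodory_solution T (\<lambda>s \<xi>. f (\<sigma> s) \<xi> (v s)) x0 x \<longrightarrow>
              caratheodory_solution T (\<lambda>s \<xi>. G s \<xi> (v s) (h (\<sigma> s) (x s))) z0 z \<longrightarrow>
              (\<forall>t\<ge>0. ereal t < T \<longrightarrow>
                 norm (x t) \<le> \<beta> (norm x0 + norm z0) t + \<rho> (norm (z t))))))"

text \<open>The two modes \<open>g 0\<close> and \<open>g 1\<close> of the scalar estimator.\<close>

definition estimator_field ::
    "real \<Rightarrow> real \<Rightarrow> (real \<Rightarrow> real) \<Rightarrow> (real \<Rightarrow> real) \<Rightarrow>
     nat \<Rightarrow> real \<Rightarrow> 'm::real_normed_vector \<Rightarrow> 'k::real_normed_vector \<Rightarrow> real" where
  "estimator_field lam_s lam_u \<gamma>1 \<gamma>2 j z v y =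
     (if j = 0 then - lam_s * z else lam_u * z) + \<gamma>1 (norm v) + \<gamma>2 (norm y)"

end

theory Submission
  imports Defs
begin

text \<open>With \<open>R t\<close> the integral of the rate of the estimator and \<open>u = \<gamma>1 (norm v) + \<gamma>2 (norm y)\<close>, the
  estimator satisfies \<open>exp (- R t) * z t = z 0 + (integral of exp (- R s) * u s over {0..t})\<close>.
  In the same way \<open>W t = V (\<sigma> t) (x t)\<close> satisfies
  \<open>exp (- A t) * W t \<le> W 0 + (integral of exp (- A s) * u s over {0..t})\<close>, where \<open>A\<close> is the
  integral of the rate of the active subsystem plus \<open>ln \<mu>\<close> for each switch. The dwell time
  conditions make unstable subsystems active for a share of at most \<open>\<Delta>u / (2 * \<delta>)\<close> of the time,
  which is at most the share \<open>\<Delta>z / (\<delta>z + \<Delta>z)\<close> of the unstable mode of the estimator, so that the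
  conditions on the rates give \<open>A t - A s \<le> R t - R s + C\<close> for \<open>s \<le> t\<close>. Therefore
  \<open>W t \<le> exp C * (exp (R t) * W 0 + z t)\<close>. Since \<open>R\<close> decreases linearly up to a bounded error, both
  parts of the definition follow.\<close>

section \<open>Indefinite Lebesgue integrals and the chain rule\<close>

text \<open>The schedule of \<open>\<zeta>\<close> is independent of that of
  \<open>\<sigma>\<close>: the estimator may run in its stable mode while an unstable subsystem is
  active, so the two rates cannot be compared pointwise. They are compared after integration, and
  over every interval from \<open>s\<close> to \<open>t\<close> instead of from 0 only, because
  \<open>u\<close> acts at every time \<open>s\<close> and reaches time \<open>t\<close> with the
  weight \<open>exp (A t - A s)\<close> in \<open>W\<close> and \<open>exp (R t - R s)\<close> in
  \<open>z\<close>. Since \<open>W\<close> and \<open>z\<close> are driven by the same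
  \<open>u\<close>, the value \<open>z t\<close> accounts for the whole input, and only the initial
  value is left for the class KL term. Here \<open>z 0 \<ge> 0\<close> matters: a negative initial
  value could cancel the integral and hide the input. Trajectories are merely absolutely continuous
  and the rates jump. For this reason \<open>primitive_on\<close> records that \<open>x\<close> is
  absolutely continuous with derivative \<open>F\<close> almost everywhere by means of the integral
  identity; \<open>integral\<close> is the gauge integral, which absolute integrability turns into
  the Lebesgue integral of \<open>caratheodory_solution\<close>.\<close>

definition primitive_on :: "real \<Rightarrow> real \<Rightarrow> (real \<Rightarrow> 'a::euclidean_space) \<Rightarrow> (real \<Rightarrow> 'a) \<Rightarrow> bool" where
  "primitive_on a b F x \<longleftrightarrow>
     F absolutely_integrable_on {a..b} \<and> (\<forall>t\<in>{a..b}. x t - x a = integral {a..t} F)"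

lemma primitive_on_integral:
  assumes "F absolutely_integrable_on {a..b}"
  shows "primitive_on a b F (\<lambda>t. c + integral {a..t} F)"
  using assms by (simp add: primitive_on_def)

lemma absolutely_integrable_imp_integrable_subinterval:
  fixes F :: "real \<Rightarrow> 'a::euclidean_space"
  assumes "F absolutely_integrable_on {a..b}" "a \<le> c" "d \<le> b"
  shows "F integrable_on {c..d}" "(\<lambda>s. norm (F s)) integrable_on {c..d}"
proof -
  have "F integrable_on {a..b}" "(\<lambda>s. norm (F s)) integrable_on {a..b}"
    using assms by (simp_all add: absolutely_integrable_on_def)
  then show "F integrable_on {c..d}" "(\<lambda>s. norm (F s)) integrable_on {c..d}"
    using assms by (auto elim!: integrable_on_subinterval)
qed

lemma primitive_on_integrable:
  assumes "primitive_on a b F x" "a \<le> c" "d \<le> b"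
  shows "F integrable_on {c..d}"
  using absolutely_integrable_imp_integrable_subinterval[OF _ assms(2,3)] assms(1)
  by (auto simp: primitive_on_def)

lemma primitive_on_diff:
  assumes P: "primitive_on a b F x" and "a \<le> c" "c \<le> d" "d \<le> b"
  shows "x d - x c = integral {c..d} F"
proof -
  have "F integrable_on {a..d}"
    using P assms by (intro primitive_on_integrable) auto
  then have "integral {a..c} F + integral {c..d} F = integral {a..d} F"
    using assms by (intro Henstock_Kurzweil_Integration.integral_combine) auto
  moreover have "x d - x a = integral {a..d} F" "x c - x a = integral {a..c} F"
    using P assms by (auto simp: primitive_on_def)
  ultimately show ?thesis by (simp add: algebra_simps)
qed

lemma primitive_on_subinterval:
  assumes P: "primitive_on a b F x" and cd: "a \<le> c" "d \<le> b"
  shows "primitive_on c d F x"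
  unfolding primitive_on_def
proof (intro conjI ballI)
  show "F absolutely_integrable_on {c..d}"
    using P cd by (auto simp: primitive_on_def intro: absolutely_integrable_on_subinterval)
  show "x t - x c = integral {c..t} F" if "t \<in> {c..d}" for t
    using primitive_on_diff[OF P, of c t] that cd by auto
qed

lemma primitive_on_continuous:
  assumes "primitive_on a b F x"
  shows "continuous_on {a..b} x"
proof -
  have "continuous_on {a..b} (\<lambda>t. x a + integral {a..t} F)"
    using assms by (intro continuous_intros indefinite_integral_continuous_1)
      (auto simp: primitive_on_def absolutely_integrable_on_def)
  moreover have "x a + integral {a..t} F = x t" if "t \<in> {a..b}" for t
  proof -
    have "x t - x a = integral {a..t} F"
      using assms that by (simp add: primitive_on_def)
    then show ?thesis by (simp add: algebra_simps)
  qed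
  ultimately show ?thesis
    by (rule continuous_on_eq)
qed

text \<open>Makes the values of the estimator field at the grid points irrelevant, where the
  left-continuous \<open>\<zeta>\<close> and the right-continuous \<open>grid_index\<close>
  disagree.\<close>

lemma primitive_on_spike:
  assumes "primitive_on a b F x" "negligible N" "\<And>s. s \<in> {a..b} - N \<Longrightarrow> G s = F s"
  shows "primitive_on a b G x"
proof -
  have "integral {a..t} F = integral {a..t} G" if "t \<in> {a..b}" for t
    using assms that by (intro integral_spike[of N]) auto
  then show ?thesis
    using assms absolutely_integrable_spike[where f=F and T="{a..b}" and S=N and g=G]
    by (simp add: primitive_on_def)
qed

lemma primitive_on_linear:
  assumes "primitive_on a b F x" "bounded_linear h"
  shows "primitive_on a b (h \<circ> F) (h \<circ> x)"
proof -
  have "integral {a..t} (h \<circ> F) = h (integral {a..t} F)" if "t \<in> {a..b}" for t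
    using assms that
    by (intro integral_linear)
      (auto intro: primitive_on_integrable)
  then show ?thesis
    using assms absolutely_integrable_linear[OF _ assms(2), where f=F and s="{a..b}"]
      linear_diff[OF bounded_linear.linear[OF assms(2)], symmetric]
    by (auto simp: primitive_on_def)
qed

lemma primitive_on_add:
  assumes "primitive_on a b F x" "primitive_on a b G y"
  shows "primitive_on a b (\<lambda>s. F s + G s) (\<lambda>s. x s + y s)"
proof -
  have "integral {a..t} (\<lambda>s. F s + G s) = integral {a..t} F + integral {a..t} G"
    if "t \<in> {a..b}" for t
    using assms that
    by (intro Henstock_Kurzweil_Integration.integral_add)
      (auto intro: primitive_on_integrable)
  then show ?thesis
    using assms set_integral_add(1)[of lebesgue "{a..b}" F G]
    by (auto simp: primitive_on_def add_diff_add)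
qed

text \<open>Two trajectories become one in the product space, so that the product rule is an
  instance of the chain rule below.\<close>

lemma primitive_on_Pair:
  assumes "primitive_on a b F x" "primitive_on a b G y"
  shows "primitive_on a b (\<lambda>s. (F s, G s)) (\<lambda>s. (x s, y s))"
proof -
  have "bounded_linear (\<lambda>u::'a. (u, 0::'b))" "bounded_linear (\<lambda>u::'b. (0::'a, u))"
    by (auto intro!: bounded_linear_Pair bounded_linear_zero bounded_linear_ident)
  then show ?thesis
    using primitive_on_add[OF primitive_on_linear[OF assms(1)] primitive_on_linear[OF assms(2)],
        of "\<lambda>u::'a. (u, 0::'b)" "\<lambda>u::'b. (0::'a, u)"]
    by (simp add: o_def)
qed

lemma continuous_inner_absolutely_integrable:
  fixes D F :: "real \<Rightarrow> 'a::euclidean_space"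
  assumes "continuous_on {a..b} D" "F absolutely_integrable_on {a..b}"
  shows "(\<lambda>s. D s \<bullet> F s) absolutely_integrable_on {a..b}"
proof (rule absolutely_integrable_bounded_measurable_product[of "(\<bullet>)"])
  show "bilinear (\<lambda>u v::'a. u \<bullet> v)"
    by (simp add: bilinear_conv_bounded_bilinear bounded_bilinear_inner)
  show "D \<in> borel_measurable (lebesgue_on {a..b})"
    by (rule continuous_imp_measurable_on_sets_lebesgue) (use assms in auto)
  show "bounded (D ` {a..b})"
    using assms by (intro compact_imp_bounded compact_continuous_image) auto
qed (use assms in auto)

text \<open>On a short interval the increment of \<open>G \<circ> x\<close> differs from the integral of the claimed
  derivative by at most \<open>\<epsilon>\<close> times the total variation of \<open>x\<close>, and such bounds add up by
  bisection; this avoids almost everywhere differentiation.\<close>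

lemma primitive_on_gradient:
  fixes x :: "real \<Rightarrow> 'a::euclidean_space" and G :: "'a \<Rightarrow> real"
  assumes P: "primitive_on a b F x"
    and G: "\<And>\<xi>. (G has_derivative (\<lambda>h. D \<xi> \<bullet> h)) (at \<xi>)"
    and D: "continuous_on UNIV D"
  shows "primitive_on a b (\<lambda>s. D (x s) \<bullet> F s) (\<lambda>s. G (x s))"
proof -
  have cx: "continuous_on {a..b} x"
    using P by (rule primitive_on_continuous)
  have cDx: "continuous_on {a..b} (\<lambda>s. D (x s))"
    using continuous_on_compose2[OF D cx] by auto
  have Fai: "F absolutely_integrable_on {a..b}"
    using P by (simp add: primitive_on_def)
  have ai: "(\<lambda>s. D (x s) \<bullet> F s) absolutely_integrable_on {a..b}"
    using cDx Fai by (rule continuous_inner_absolutely_integrable)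
  have key: "\<bar>(G (x t) - G (x a)) - integral {a..t} (\<lambda>s. D (x s) \<bullet> F s)\<bar>
      \<le> \<epsilon> * integral {a..t} (\<lambda>s. norm (F s))"
    if t: "a \<le> t" "t \<le> b" and \<epsilon>: "0 < \<epsilon>" for t \<epsilon>
  proof -
    \<comment> \<open>The guard is part of \<open>Q\<close> because the local case of
      \<open>Bolzano\<close> ranges over all short intervals around \<open>r\<close>, including
      those that leave \<open>{a..t}\<close>.\<close>
    define Q where "Q c d \<longleftrightarrow> (a \<le> c \<and> c \<le> d \<and> d \<le> t \<longrightarrow>
        \<bar>(G (x d) - G (x c)) - integral {c..d} (\<lambda>s. D (x s) \<bullet> F s)\<bar>
          \<le> \<epsilon> * integral {c..d} (\<lambda>s. norm (F s)))" for c d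
    have int: "(\<lambda>s. D (x s) \<bullet> F s) integrable_on {c..d}" "(\<lambda>s. norm (F s)) integrable_on {c..d}"
      "F integrable_on {c..d}"
      if "a \<le> c" "d \<le> t" for c d
      using absolutely_integrable_imp_integrable_subinterval[OF ai, of c d]
        absolutely_integrable_imp_integrable_subinterval[OF Fai, of c d] that t by auto
    have "Q a t"
      using t(1)
    proof (induction rule: Bolzano)
      case (trans c d e)
      show ?case
        unfolding Q_def
      proof
        assume ce: "a \<le> c \<and> c \<le> e \<and> e \<le> t"
        have "integral {c..d} (\<lambda>s. D (x s) \<bullet> F s) + integral {d..e} (\<lambda>s. D (x s) \<bullet> F s)
            = integral {c..e} (\<lambda>s. D (x s) \<bullet> F s)"
          using ce trans int by (auto intro!: Henstock_Kurzweil_Integration.integral_combine)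
        moreover have "\<epsilon> * integral {c..e} (\<lambda>s. norm (F s))
            = \<epsilon> * integral {c..d} (\<lambda>s. norm (F s)) + \<epsilon> * integral {d..e} (\<lambda>s. norm (F s))"
          using Henstock_Kurzweil_Integration.integral_combine[of c d e "\<lambda>s. norm (F s)"]
            ce trans(3,4) int(2)[of c e] by (simp flip: distrib_left)
        moreover have "\<bar>(G (x d) - G (x c)) - integral {c..d} (\<lambda>s. D (x s) \<bullet> F s)\<bar>
          \<le> \<epsilon> * integral {c..d} (\<lambda>s. norm (F s))"
          "\<bar>(G (x e) - G (x d)) - integral {d..e} (\<lambda>s. D (x s) \<bullet> F s)\<bar>
          \<le> \<epsilon> * integral {d..e} (\<lambda>s. norm (F s))"
          using trans ce by (auto simp: Q_def)
        ultimately show "\<bar>(G (x e) - G (x c)) - integral {c..e} (\<lambda>s. D (x s) \<bullet> F s)\<bar>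
          \<le> \<epsilon> * integral {c..e} (\<lambda>s. norm (F s))"
          by linarith
      qed
    next
      case (local r)
      have "isCont D (x r)"
        using D by (simp add: continuous_on_eq_continuous_at)
      \<comment> \<open>Half of \<epsilon> is spent on linearizing \<open>G\<close> at
        \<open>x r\<close>, the other half on replacing \<open>D (x r)\<close> by
        \<open>D (x s)\<close> under the integral.\<close>
      then obtain \<rho> where \<rho>: "0 < \<rho>" "\<And>\<xi>. dist \<xi> (x r) < \<rho> \<Longrightarrow> dist (D \<xi>) (D (x r)) < \<epsilon> / 2"
        using \<epsilon> unfolding continuous_at_eps_delta by (meson half_gt_zero)
      have "r \<in> {a..b}" using local t by auto
      then obtain \<eta> where \<eta>: "0 < \<eta>" "\<And>s. s \<in> {a..b} \<Longrightarrow> dist s r < \<eta> \<Longrightarrow> dist (x s) (x r) < \<rho>"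
        using cx \<rho>(1) unfolding continuous_on_iff by meson
      have "Q c d" if cd: "c \<le> r" "r \<le> d" "d - c < \<eta>" for c d
        unfolding Q_def
      proof
        assume act: "a \<le> c \<and> c \<le> d \<and> d \<le> t"
        have near: "x s \<in> ball (x r) \<rho>" if "s \<in> {c..d}" for s
          using \<eta>(2)[of s] that act t cd by (auto simp: dist_real_def dist_commute)
        have Dn: "norm (D \<xi> - D (x r)) \<le> \<epsilon> / 2" if "\<xi> \<in> ball (x r) \<rho>" for \<xi>
          using \<rho>(2)[of \<xi>] that by (auto simp: dist_norm norm_minus_commute)
        have seg: "x c + s *\<^sub>R (x d - x c) \<in> ball (x r) \<rho>" if "s \<in> {0..1}" for s
        proof -
          have "(1 - s) *\<^sub>R x c + s *\<^sub>R x d \<in> ball (x r) \<rho>"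
            using that near[of c] near[of d] act by (intro convexD[OF convex_ball]) auto
          then show ?thesis by (simp add: algebra_simps)
        qed
        have "norm (G (x d) - G (x c) - D (x r) \<bullet> (x d - x c)) \<le> norm (x d - x c) * (\<epsilon> / 2)"
        proof (rule differentiable_bound_linearization[where f' = "\<lambda>\<xi> h. D \<xi> \<bullet> h"])
          show "(G has_derivative (\<bullet>) (D \<xi>)) (at \<xi> within ball (x r) \<rho>)" for \<xi>
            using G by (rule has_derivative_at_withinI)
          show "onorm ((\<bullet>) (D \<xi>) - (\<bullet>) (D (x r))) \<le> \<epsilon> / 2" if "\<xi> \<in> ball (x r) \<rho>" for \<xi>
          proof (rule onorm_le)
            fix h
            have "norm ((D \<xi> - D (x r)) \<bullet> h) \<le> norm (D \<xi> - D (x r)) * norm h"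
              using Cauchy_Schwarz_ineq2[of "D \<xi> - D (x r)" h] by simp
            also have "\<dots> \<le> \<epsilon> / 2 * norm h"
              using Dn[OF that] by (intro mult_right_mono) auto
            finally show "norm (((\<bullet>) (D \<xi>) - (\<bullet>) (D (x r))) h) \<le> \<epsilon> / 2 * norm h"
              by (simp add: inner_diff_left)
          qed
        qed (use seg \<rho> in auto)
        moreover have dx: "x d - x c = integral {c..d} F"
          using P act t by (intro primitive_on_diff) auto
        have "norm (x d - x c) \<le> integral {c..d} (\<lambda>s. norm (F s))"
          unfolding dx using int act by (intro integral_norm_bound_integral) auto
        then have "norm (x d - x c) * (\<epsilon> / 2) \<le> integral {c..d} (\<lambda>s. norm (F s)) * (\<epsilon> / 2)"
          using \<epsilon> by (intro mult_right_mono) auto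
        moreover have "norm (integral {c..d} (\<lambda>s. (D (x r) - D (x s)) \<bullet> F s))
            \<le> integral {c..d} (\<lambda>s. \<epsilon> / 2 * norm (F s))"
        proof (rule integral_norm_bound_integral)
          show "(\<lambda>s. (D (x r) - D (x s)) \<bullet> F s) integrable_on {c..d}"
            unfolding inner_diff_left using int act
            by (intro integrable_diff) (auto simp: o_def intro: integrable_linear[unfolded o_def] bounded_linear_inner_right)
          show "(\<lambda>s. \<epsilon> / 2 * norm (F s)) integrable_on {c..d}"
            using int act integrable_on_cmult_left by fastforce
          fix s assume "s \<in> {c..d}"
          then have "norm (D (x r) - D (x s)) * norm (F s) \<le> \<epsilon> / 2 * norm (F s)"
            using Dn[OF near, of s] by (intro mult_right_mono) (auto simp: norm_minus_commute)
          then show "norm ((D (x r) - D (x s)) \<bullet> F s) \<le> \<epsilon> / 2 * norm (F s)"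
            using Cauchy_Schwarz_ineq2[of "D (x r) - D (x s)" "F s"] by simp
        qed
        moreover have "integral {c..d} (\<lambda>s. (D (x r) - D (x s)) \<bullet> F s)
            = D (x r) \<bullet> integral {c..d} F - integral {c..d} (\<lambda>s. D (x s) \<bullet> F s)"
        proof -
          have "integral {c..d} (\<lambda>s. D (x r) \<bullet> F s) = D (x r) \<bullet> integral {c..d} F"
            using integral_linear[OF int(3) bounded_linear_inner_right] act by (simp add: o_def)
          moreover have "(\<lambda>s. D (x r) \<bullet> F s) integrable_on {c..d}"
            using integrable_linear[OF int(3) bounded_linear_inner_right] act by (simp add: o_def)
          ultimately show ?thesis
            unfolding inner_diff_left using int act
            by (subst Henstock_Kurzweil_Integration.integral_diff) auto
        qed
        moreover have "integral {c..d} (\<lambda>s. \<epsilon> / 2 * norm (F s))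
            = \<epsilon> / 2 * integral {c..d} (\<lambda>s. norm (F s))"
          by (rule integral_mult_right)
        ultimately have
          "\<bar>G (x d) - G (x c) - D (x r) \<bullet> integral {c..d} F\<bar> \<le> (\<epsilon> * integral {c..d} (\<lambda>s. norm (F s))) / 2"
          "\<bar>D (x r) \<bullet> integral {c..d} F - integral {c..d} (\<lambda>s. D (x s) \<bullet> F s)\<bar>
            \<le> (\<epsilon> * integral {c..d} (\<lambda>s. norm (F s))) / 2"
          unfolding dx real_norm_def by (simp_all add: mult.commute)
        then show "\<bar>(G (x d) - G (x c)) - integral {c..d} (\<lambda>s. D (x s) \<bullet> F s)\<bar>
          \<le> \<epsilon> * integral {c..d} (\<lambda>s. norm (F s))"
          by linarith
      qed
      then show ?case using \<eta>(1) by blast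
    qed
    then show ?thesis using t by (simp add: Q_def)
  qed
  have "G (x t) - G (x a) = integral {a..t} (\<lambda>s. D (x s) \<bullet> F s)" if t: "a \<le> t" "t \<le> b" for t
  proof -
    let ?e = "\<bar>(G (x t) - G (x a)) - integral {a..t} (\<lambda>s. D (x s) \<bullet> F s)\<bar>"
    let ?I = "integral {a..t} (\<lambda>s. norm (F s))"
    have "?e \<le> 0"
    proof (rule field_le_epsilon)
      fix e :: real assume e: "0 < e"
      have I: "0 \<le> ?I"
        by (rule integral_nonneg)
          (use absolutely_integrable_imp_integrable_subinterval[OF Fai, of a t] t in auto)
      \<comment> \<open>The variation \<open>?I\<close> may vanish, hence the division by
        \<open>?I + 1\<close>.\<close>
      have "?e \<le> e / (?I + 1) * ?I"
        using key[OF t, of "e / (?I + 1)"] e I by simp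
      also have "\<dots> \<le> e"
        using e I by (simp add: field_simps)
      finally show "?e \<le> 0 + e" by simp
    qed
    then show ?thesis by simp
  qed
  then show ?thesis
    using ai by (auto simp: primitive_on_def)
qed

section \<open>Linear differential equations and Lyapunov functions\<close>

text \<open>Product rule for an integrating factor: the chain rule for
  \<open>exp (snd p) * fst p\<close> along the pair of \<open>z\<close> and
  \<open>R\<close>.\<close>

lemma primitive_on_exp_times:
  fixes z R :: "real \<Rightarrow> real"
  assumes "primitive_on a b F z" "primitive_on a b r R"
  shows "primitive_on a b (\<lambda>s. exp (R s) * (F s + r s * z s)) (\<lambda>s. exp (R s) * z s)"
proof -
  have "((\<lambda>p::real \<times> real. exp (snd p) * fst p) has_derivative
      (\<lambda>h. (exp (snd p), exp (snd p) * fst p) \<bullet> h)) (at p)" for p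
    by (auto intro!: derivative_eq_intros simp: inner_prod_def algebra_simps)
  moreover have "continuous_on UNIV (\<lambda>p::real \<times> real. (exp (snd p), exp (snd p) * fst p))"
    by (intro continuous_intros)
  ultimately have "primitive_on a b
      (\<lambda>s. (exp (snd (z s, R s)), exp (snd (z s, R s)) * fst (z s, R s)) \<bullet> (F s, r s))
      (\<lambda>s. exp (snd (z s, R s)) * fst (z s, R s))"
    by (rule primitive_on_gradient[OF primitive_on_Pair[OF assms]])
  then show ?thesis
    by (simp add: inner_prod_def algebra_simps)
qed

lemma primitive_on_uminus:
  assumes "primitive_on a b F x"
  shows "primitive_on a b (\<lambda>s. - F s) (\<lambda>s. - x s)"
  using primitive_on_linear[OF assms bounded_linear_minus[OF bounded_linear_ident]]
  by (simp add: o_def)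

text \<open>Riesz representation, with the gradient assembled from the values of the derivative on
  the basis. It connects \<open>frechet_derivative\<close>, in which the decay conditions are
  phrased, with the inner product form of the chain rule.\<close>

lemma continuously_differentiable_gradient:
  fixes V :: "'a::euclidean_space \<Rightarrow> real"
  assumes "continuously_differentiable V"
  obtains D where "continuous_on UNIV D" "\<And>\<xi>. (V has_derivative (\<lambda>h. D \<xi> \<bullet> h)) (at \<xi>)"
    "\<And>\<xi> h. frechet_derivative V (at \<xi>) h = D \<xi> \<bullet> h"
proof -
  obtain F' :: "'a \<Rightarrow> 'a \<Rightarrow>\<^sub>L real" where F': "continuous_on UNIV F'"
    "\<And>x. (V has_derivative blinfun_apply (F' x)) (at x)"
    using assms unfolding continuously_differentiable_def by blast
  define D where "D \<xi> = (\<Sum>b\<in>Basis. F' \<xi> b *\<^sub>R b)" for \<xi>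
  have eq: "F' \<xi> h = D \<xi> \<bullet> h" for \<xi> h
  proof -
    have "F' \<xi> h = F' \<xi> (\<Sum>b\<in>Basis. (h \<bullet> b) *\<^sub>R b)"
      by (simp add: euclidean_representation)
    also have "\<dots> = (\<Sum>b\<in>Basis. (h \<bullet> b) * F' \<xi> b)"
      by (simp add: blinfun.sum_right blinfun.scaleR_right)
    also have "\<dots> = D \<xi> \<bullet> h"
      by (simp add: D_def inner_sum_left inner_commute[of h] mult.commute)
    finally show ?thesis .
  qed
  show ?thesis
  proof (rule that)
    show "continuous_on UNIV D"
      unfolding D_def by (intro continuous_intros F'(1))
    show d: "(V has_derivative (\<lambda>h. D \<xi> \<bullet> h)) (at \<xi>)" for \<xi>
      using F'(2)[of \<xi>] by (simp add: eq[abs_def])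
    show "frechet_derivative V (at \<xi>) h = D \<xi> \<bullet> h" for \<xi> h
      using frechet_derivative_at[OF d] by metis
  qed
qed

text \<open>By the product rule the derivative of \<open>exp (- R s) * V (x s)\<close> is at most
  \<open>exp (- R s) * u s\<close>. The differential inequality is assumed on a half-open interval
  since at a switching instant the next subsystem is already active.\<close>

lemma lyapunov_comparison:
  fixes x :: "real \<Rightarrow> 'a::euclidean_space" and V :: "'a \<Rightarrow> real"
  assumes x: "primitive_on a b F x" and R: "primitive_on a b r R" and ab: "a \<le> b"
    and V: "continuously_differentiable V"
    and le: "\<And>s. s \<in> {a..<b} \<Longrightarrow>
      frechet_derivative V (at (x s)) (F s) \<le> r s * V (x s) + u s"
    and u: "(\<lambda>s. exp (- R s) * u s) integrable_on {a..b}"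
  shows "exp (- R b) * V (x b) \<le> exp (- R a) * V (x a) + integral {a..b} (\<lambda>s. exp (- R s) * u s)"
proof -
  obtain D where D: "continuous_on UNIV D" "\<And>\<xi>. (V has_derivative (\<lambda>h. D \<xi> \<bullet> h)) (at \<xi>)"
    "\<And>\<xi> h. frechet_derivative V (at \<xi>) h = D \<xi> \<bullet> h"
    using continuously_differentiable_gradient[OF V] by metis
  have P: "primitive_on a b (\<lambda>s. exp (- R s) * (D (x s) \<bullet> F s - r s * V (x s)))
      (\<lambda>s. exp (- R s) * V (x s))"
    using primitive_on_exp_times[OF primitive_on_gradient[OF x D(2,1)] primitive_on_uminus[OF R]]
    by simp
  have "exp (- R b) * V (x b) - exp (- R a) * V (x a)
      = integral {a..b} (\<lambda>s. exp (- R s) * (D (x s) \<bullet> F s - r s * V (x s)))"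
    using primitive_on_diff[OF P, of a b] ab by simp
  also have "\<dots> = integral {a..b}
      (\<lambda>s. if s = b then exp (- R s) * u s else exp (- R s) * (D (x s) \<bullet> F s - r s * V (x s)))"
    by (rule integral_spike[of "{b}"]) auto
  also have "\<dots> \<le> integral {a..b} (\<lambda>s. exp (- R s) * u s)"
  proof (rule integral_le)
    show "(\<lambda>s. if s = b then exp (- R s) * u s else exp (- R s) * (D (x s) \<bullet> F s - r s * V (x s)))
        integrable_on {a..b}"
      by (rule integrable_spike[OF primitive_on_integrable[OF P order_refl order_refl], of "{b}"]) auto
    show "(if s = b then exp (- R s) * u s else exp (- R s) * (D (x s) \<bullet> F s - r s * V (x s)))
        \<le> exp (- R s) * u s" if "s \<in> {a..b}" for s
      using le[of s] that by (auto simp: D(3))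
  qed (use u in auto)
  finally show ?thesis by simp
qed

section \<open>Caratheodory solutions and scalar linear equations\<close>

lemma caratheodory_solution_primitive_on:
  assumes "caratheodory_solution T F x0 x" "0 \<le> t" "ereal t < T"
  shows "primitive_on 0 t (\<lambda>s. F s (x s)) x" "x 0 = x0"
proof -
  have less: "ereal s < T" if "s \<in> {0..t}" for s
    using that assms(3) order.strict_trans1[of "ereal s" "ereal t" T] by simp
  have x: "(\<lambda>s. F s (x s)) absolutely_integrable_on {0..s}"
    "x s = x0 + integral {0..s} (\<lambda>s. F s (x s))" if "s \<in> {0..t}" for s
    using assms(1) less[OF that] that set_lebesgue_integral_eq_integral(2)[of "{0..s}" "\<lambda>s. F s (x s)"]
    unfolding caratheodory_solution_def by auto
  show x0: "x 0 = x0" using x(2)[of 0] assms(2) by simp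
  have "x s - x 0 = integral {0..s} (\<lambda>s. F s (x s))" if "s \<in> {0..t}" for s
    using x(2)[OF that] unfolding x0 by (simp only: add_diff_cancel_left')
  then show "primitive_on 0 t (\<lambda>s. F s (x s)) x"
    using x(1)[of t] assms(2) unfolding primitive_on_def by simp
qed

lemma primitive_on_caratheodory_solution:
  assumes "\<And>t. 0 \<le> t \<Longrightarrow> ereal t < T \<Longrightarrow> primitive_on 0 t (\<lambda>s. F s (x s)) x" "x 0 = x0"
  shows "caratheodory_solution T F x0 x"
  unfolding caratheodory_solution_def
proof (intro allI impI)
  fix t :: real assume t: "0 \<le> t" "ereal t < T"
  have "(\<lambda>s. F s (x s)) absolutely_integrable_on {0..t}"
    "x t - x 0 = integral {0..t} (\<lambda>s. F s (x s))"
    using assms(1)[OF t] t by (auto simp: primitive_on_def)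
  then show "set_integrable lebesgue {0..t} (\<lambda>s. F s (x s)) \<and>
      x t = x0 + (LINT s:{0..t}|lebesgue. F s (x s))"
    using set_lebesgue_integral_eq_integral(2)[of "{0..t}" "\<lambda>s. F s (x s)"] assms(2)
    by (simp add: diff_eq_eq add.commute)
qed

lemma continuous_times_absolutely_integrable:
  fixes g u :: "real \<Rightarrow> real"
  assumes "continuous_on {a..b} g" "u absolutely_integrable_on {a..b}"
  shows "(\<lambda>s. g s * u s) absolutely_integrable_on {a..b}"
  using continuous_inner_absolutely_integrable[OF assms] by simp

lemma linear_ode_solution:
  fixes z :: "real \<Rightarrow> real"
  assumes z: "primitive_on 0 t (\<lambda>s. r s * z s + u s) z" and R: "primitive_on 0 t r R"
    and t: "0 \<le> t"
  shows "exp (- R t) * z t = exp (- R 0) * z 0 + integral {0..t} (\<lambda>s. exp (- R s) * u s)"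
proof -
  have P: "primitive_on 0 t (\<lambda>s. exp (- R s) * u s) (\<lambda>s. exp (- R s) * z s)"
    using primitive_on_exp_times[OF z primitive_on_uminus[OF R]] by simp
  show ?thesis
    using primitive_on_diff[OF P, of 0 t] t by (simp add: algebra_simps)
qed

text \<open>Variation of constants read as a construction. It is required because
  \<open>iss_wrt_input_output\<close> asks for the existence of a solution besides the bound on all
  solutions.\<close>

lemma linear_ode_exists:
  fixes r u R :: "real \<Rightarrow> real" and c :: real
  assumes R: "primitive_on 0 t r R" and u: "u absolutely_integrable_on {0..t}"
  defines "z \<equiv> \<lambda>s. exp (R s) * (c + integral {0..s} (\<lambda>s. exp (- R s) * u s))"
  shows "primitive_on 0 t (\<lambda>s. r s * z s + u s) z"
proof -
  have "continuous_on {0..t} R"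
    using R by (rule primitive_on_continuous)
  then have "(\<lambda>s. exp (- R s) * u s) absolutely_integrable_on {0..t}"
    by (intro continuous_times_absolutely_integrable u continuous_intros)
  then have "primitive_on 0 t (\<lambda>s. exp (R s) * (exp (- R s) * u s
      + r s * (c + integral {0..s} (\<lambda>s. exp (- R s) * u s)))) z"
    unfolding z_def by (intro primitive_on_exp_times primitive_on_integral R)
  moreover have "exp (R s) * (exp (- R s) * u s + r s * (c + integral {0..s} (\<lambda>s. exp (- R s) * u s)))
      = r s * z s + u s" for s
    by (simp add: z_def exp_minus field_simps)
  ultimately show ?thesis by simp
qed

text \<open>In the comparison of \<open>x\<close> with \<open>z\<close> the output along
  \<open>x\<close> is not known to be essentially bounded. Its contribution \<open>u\<close> is
  integrable all the same, as the difference of the right-hand side of the equation for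
  \<open>z\<close> and the term \<open>r s * z s\<close>, where \<open>z\<close> is
  continuous.\<close>

lemma linear_ode_integrable_input:
  fixes z :: "real \<Rightarrow> real"
  assumes z: "primitive_on a b (\<lambda>s. r s * z s + u s) z" and r: "r absolutely_integrable_on {a..b}"
  shows "u absolutely_integrable_on {a..b}"
proof -
  have "(\<lambda>s. z s * r s) absolutely_integrable_on {a..b}"
    using primitive_on_continuous[OF z] r by (rule continuous_times_absolutely_integrable)
  moreover have "(\<lambda>s. r s * z s + u s) absolutely_integrable_on {a..b}"
    using z by (simp add: primitive_on_def)
  ultimately have "(\<lambda>s. (r s * z s + u s) - z s * r s) absolutely_integrable_on {a..b}"
    by (intro set_integral_diff(1)) auto
  then show ?thesis by (simp add: algebra_simps)
qed

text \<open>The kernel \<open>exp (R t - R s)\<close> is at most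
  \<open>exp C * exp (- \<kappa> * (t - s))\<close>, whose integral over \<open>{0..t}\<close> stays
  below \<open>exp C / \<kappa>\<close> for all \<open>t\<close>. This produces a gain that is
  uniform in time.\<close>

lemma integral_exp_decay_le:
  fixes u :: "real \<Rightarrow> real"
  assumes "0 \<le> t" "0 < \<kappa>" "0 \<le> B"
    and decay: "\<And>s. s \<in> {0..t} \<Longrightarrow> R t - R s \<le> C - \<kappa> * (t - s)"
    and int: "(\<lambda>s. exp (- R s) * u s) integrable_on {0..t}"
    and N: "negligible N" "\<And>s. s \<in> {0..t} - N \<Longrightarrow> 0 \<le> u s \<and> u s \<le> B"
  shows "exp (R t) * integral {0..t} (\<lambda>s. exp (- R s) * u s) \<le> exp C * B / \<kappa>"
proof -
  \<comment> \<open>Off \<open>N\<close> the integrand is unchanged; setting it to 0 on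
    \<open>N\<close> makes the bound by the exponential hold at every point.\<close>
  let ?w = "\<lambda>s. if s \<in> N then 0 else exp (- R s) * u s"
  have "((\<lambda>s. exp (C - \<kappa> * (t - s)) * B) has_integral
      exp (C - \<kappa> * (t - t)) * B / \<kappa> - exp (C - \<kappa> * (t - 0)) * B / \<kappa>) {0..t}"
    using assms(1,2)
    by (intro fundamental_theorem_of_calculus)
      (auto intro!: derivative_eq_intros simp flip: has_real_derivative_iff_has_vector_derivative)
  moreover have w: "((\<lambda>s. exp (R t) * ?w s) has_integral
      exp (R t) * integral {0..t} (\<lambda>s. exp (- R s) * u s)) {0..t}"
    by (intro has_integral_mult_right has_integral_spike[OF N(1) _ integrable_integral[OF int]]) auto
  moreover have "exp (R t) * ?w s \<le> exp (C - \<kappa> * (t - s)) * B" if s: "s \<in> {0..t}" for s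
  proof (cases "s \<in> N")
    case False
    have "exp (R t) * ?w s = exp (R t - R s) * u s"
      using False by (simp add: exp_diff exp_minus field_simps)
    also have "\<dots> \<le> exp (C - \<kappa> * (t - s)) * B"
      using decay[OF s] N(2)[of s] s False by (intro mult_mono) auto
    finally show ?thesis .
  qed (use assms in auto)
  ultimately have "exp (R t) * integral {0..t} (\<lambda>s. exp (- R s) * u s)
      \<le> exp (C - \<kappa> * (t - t)) * B / \<kappa> - exp (C - \<kappa> * (t - 0)) * B / \<kappa>"
    by (meson has_integral_le)
  also have "\<dots> \<le> exp C * B / \<kappa>" using assms by simp
  finally show ?thesis .
qed

section \<open>Piecewise constant functions on a time grid\<close>

text \<open>Shared by the switching instants of \<open>\<sigma>\<close> and by the phase boundaries
  of \<open>\<zeta>\<close>, so that both rates become functions of a cell number.\<close>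

definition time_grid :: "(nat \<Rightarrow> real) \<Rightarrow> bool" where
  "time_grid \<tau> \<longleftrightarrow> \<tau> 0 = 0 \<and> strict_mono \<tau> \<and> filterlim \<tau> at_top sequentially"

text \<open>On a time grid and for \<open>s \<ge> 0\<close> this is the number of the half-open cell
  containing \<open>s\<close>, and at the same time the number of switches up to and including
  \<open>s\<close>. The form with \<open>LEAST\<close> gives measurability without any condition on
  the grid.\<close>

definition grid_index :: "(nat \<Rightarrow> real) \<Rightarrow> real \<Rightarrow> nat" where
  "grid_index \<tau> s = (LEAST i. s < \<tau> (Suc i))"

lemma time_grid_exceeds:
  assumes "time_grid \<tau>"
  shows "\<exists>i. s < \<tau> (Suc i)"
proof -
  have "\<forall>\<^sub>F i in sequentially. s < \<tau> i"
    using assms by (auto simp: time_grid_def filterlim_at_top_dense)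
  then obtain n where "\<forall>i\<ge>n. s < \<tau> i"
    by (auto simp: eventually_sequentially)
  then show ?thesis by (auto intro: exI[of _ n])
qed

lemma grid_index_less: "time_grid \<tau> \<Longrightarrow> s < \<tau> (Suc (grid_index \<tau> s))"
  unfolding grid_index_def using time_grid_exceeds by (rule LeastI_ex)

lemma grid_index_le:
  assumes "time_grid \<tau>" "0 \<le> s"
  shows "\<tau> (grid_index \<tau> s) \<le> s"
proof (cases "grid_index \<tau> s")
  case 0
  then show ?thesis using assms by (simp add: time_grid_def)
next
  case (Suc j)
  then have "\<not> s < \<tau> (Suc j)"
    unfolding grid_index_def using not_less_Least[of j "\<lambda>i. s < \<tau> (Suc i)"] by simp
  then show ?thesis using Suc by simp
qed

lemma grid_index_mono:
  assumes "time_grid \<tau>" "s \<le> t"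
  shows "grid_index \<tau> s \<le> grid_index \<tau> t"
  unfolding grid_index_def[of _ s]
  using order.strict_trans1[OF assms(2) grid_index_less[OF assms(1)]] by (rule Least_le)

lemma time_grid_mono: "time_grid \<tau> \<Longrightarrow> i \<le> j \<Longrightarrow> \<tau> i \<le> \<tau> j"
  by (simp add: time_grid_def strict_mono_less_eq)

lemma time_grid_nonneg: "time_grid \<tau> \<Longrightarrow> 0 \<le> \<tau> i"
  using time_grid_mono[of \<tau> 0 i] by (simp add: time_grid_def)

lemma grid_index_eq:
  assumes "time_grid \<tau>" "s \<in> {\<tau> i..<\<tau> (Suc i)}"
  shows "grid_index \<tau> s = i"
proof (rule antisym)
  show "grid_index \<tau> s \<le> i"
    unfolding grid_index_def using assms by (intro Least_le) auto
  show "i \<le> grid_index \<tau> s"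
    using time_grid_mono[OF assms(1), of "Suc (grid_index \<tau> s)" i] grid_index_less[OF assms(1), of s]
      assms(2) by fastforce
qed

lemma grid_index_measurable [measurable]:
  "grid_index \<tau> \<in> measurable borel (count_space UNIV)"
  unfolding grid_index_def by measurable

lemma grid_function_measurable:
  "(\<lambda>s. \<rho> (grid_index \<tau> s) :: real) \<in> borel_measurable (lebesgue_on S)"
proof -
  have "(\<lambda>s. \<rho> (grid_index \<tau> s)) \<in> borel_measurable borel"
    by measurable
  then show ?thesis
    by (intro measurable_restrict_space1 measurable_completion) simp
qed

lemma grid_function_bounded:
  assumes "time_grid \<tau>"
  shows "bounded ((\<lambda>s. \<rho> (grid_index \<tau> s) :: real) ` {a..b})"
proof (rule boundedI)
  fix y assume "y \<in> (\<lambda>s. \<rho> (grid_index \<tau> s)) ` {a..b}"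
  then obtain s where s: "y = \<rho> (grid_index \<tau> s)" "s \<in> {a..b}" by blast
  have "\<bar>\<rho> (grid_index \<tau> s)\<bar> \<le> (\<Sum>i\<le>grid_index \<tau> b. \<bar>\<rho> i\<bar>)"
    using grid_index_mono[OF assms, of s b] s(2)
    by (intro member_le_sum[of _ _ "\<lambda>i. \<bar>\<rho> i\<bar>"]) auto
  then show "norm y \<le> (\<Sum>i\<le>grid_index \<tau> b. \<bar>\<rho> i\<bar>)" using s by simp
qed

lemma grid_function_times_absolutely_integrable:
  fixes u :: "real \<Rightarrow> real"
  assumes "time_grid \<tau>" "u absolutely_integrable_on {a..b}"
  shows "(\<lambda>s. \<rho> (grid_index \<tau> s) * u s) absolutely_integrable_on {a..b}"
  using grid_function_measurable _ grid_function_bounded[OF assms(1)] assms(2)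
  by (rule absolutely_integrable_bounded_measurable_product_real) auto

lemma grid_function_absolutely_integrable:
  assumes "time_grid \<tau>"
  shows "(\<lambda>s. \<rho> (grid_index \<tau> s) :: real) absolutely_integrable_on {a..b}"
  using grid_function_times_absolutely_integrable[OF assms, where u = "\<lambda>_. 1"]
  by (simp add: absolutely_integrable_continuous_real)

lemma grid_function_integral:
  fixes \<rho> :: "nat \<Rightarrow> real"
  assumes "time_grid \<tau>" "\<tau> i \<le> a" "a \<le> b" "b \<le> \<tau> (Suc i)"
  shows "integral {a..b} (\<lambda>s. \<rho> (grid_index \<tau> s)) = \<rho> i * (b - a)"
proof -
  have "integral {a..b} (\<lambda>s. \<rho> (grid_index \<tau> s)) = integral {a..b} (\<lambda>s. \<rho> i)"
  proof (rule integral_spike[of "{\<tau> (Suc i)}"])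
    show "\<rho> i = \<rho> (grid_index \<tau> s)" if "s \<in> {a..b} - {\<tau> (Suc i)}" for s
      using grid_index_eq[OF assms(1), of s i] that assms by auto
  qed auto
  then show ?thesis using assms by (simp add: mult.commute)
qed

lemma primitive_on_grid_function:
  fixes \<rho> :: "nat \<Rightarrow> real"
  assumes "time_grid \<tau>"
  shows "primitive_on 0 t (\<lambda>s. \<rho> (grid_index \<tau> s)) (\<lambda>t. integral {0..t} (\<lambda>s. \<rho> (grid_index \<tau> s)))"
  using primitive_on_integral[OF grid_function_absolutely_integrable[OF assms], where a = 0 and b = t and c = 0] by simp

text \<open>If there is a switch after \<open>s\<close> and up to \<open>t\<close>, the first and
  the last one enclose one complete cell fewer than there are switches, each of length at least
  \<open>\<delta>\<close>. The summand 1 pays for that difference.\<close>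

lemma grid_index_diff_le:
  assumes \<tau>: "time_grid \<tau>" and \<delta>: "0 < \<delta>" "\<And>i. \<delta> \<le> \<tau> (Suc i) - \<tau> i" and st: "0 \<le> s" "s \<le> t"
  shows "real (grid_index \<tau> t) - real (grid_index \<tau> s) \<le> (t - s) / \<delta> + 1"
proof -
  have gap: "real k * \<delta> \<le> \<tau> (i + k) - \<tau> i" for i k
  proof (induction k)
    case (Suc k)
    then show ?case using \<delta>(2)[of "i + k"] by (simp add: algebra_simps)
  qed simp
  define i j where "i = grid_index \<tau> s" and "j = grid_index \<tau> t"
  have ij: "i \<le> j" unfolding i_def j_def using \<tau> st(2) by (rule grid_index_mono)
  have "(real j - real i - 1) * \<delta> \<le> t - s"
  proof (cases "i = j")
    case True
    then show ?thesis using st \<delta>(1) by simp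
  next
    case False
    then have "real (j - Suc i) * \<delta> \<le> \<tau> j - \<tau> (Suc i)"
      using gap[of "j - Suc i" "Suc i"] ij by simp
    also have "\<dots> \<le> t - s"
      using grid_index_le[OF \<tau>, of t] grid_index_less[OF \<tau>, of s] st by (simp add: i_def j_def)
    finally show ?thesis using False ij by (simp add: of_nat_diff algebra_simps)
  qed
  then have "real j - real i - 1 \<le> (t - s) / \<delta>"
    using \<delta>(1) by (simp add: pos_le_divide_eq)
  then show ?thesis by (simp add: i_def j_def)
qed

text \<open>A stretch spent in \<open>\<phi> = 1\<close> lasts at most \<open>\<Delta>\<close> and is followed by one of length at least
  \<open>\<delta>\<close>, so \<open>\<phi> = 1\<close> takes up a share of at most \<open>\<Delta> / (\<Delta> + \<delta>)\<close> of the time; for \<open>\<delta> \<le> \<Delta>\<close> this is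
  below \<open>\<Delta> / (2 * \<delta>)\<close>.\<close>

lemma activation_time_le:
  assumes \<tau>: "time_grid \<tau>" and \<phi>: "\<And>i. \<phi> i = 0 \<or> \<phi> i = (1::real)"
    and alt: "\<And>i. \<phi> i = 1 \<Longrightarrow> \<phi> (Suc i) = 0"
    and \<delta>: "0 < \<delta>" "\<delta> \<le> \<Delta>u"
    and len: "\<And>i. \<delta> \<le> \<tau> (Suc i) - \<tau> i" "\<And>i. \<tau> (Suc i) - \<tau> i \<le> \<Delta>"
      "\<And>i. \<phi> i = 1 \<Longrightarrow> \<tau> (Suc i) - \<tau> i \<le> \<Delta>u"
    and st: "0 \<le> s" "s \<le> t"
  defines "U \<equiv> \<lambda>t. integral {0..t} (\<lambda>s. \<phi> (grid_index \<tau> s))"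
  shows "U t - U s \<le> \<Delta>u / (2 * \<delta>) * (t - s) + (2 * \<Delta>u + \<Delta>u / (2 * \<delta>) * \<Delta>)"
proof -
  define \<theta> where "\<theta> = \<Delta>u / (2 * \<delta>)"
  have \<theta>: "1 / 2 \<le> \<theta>" "\<theta> * \<delta> = \<Delta>u / 2"
    using \<delta> by (auto simp: \<theta>_def field_simps)
  have U: "U b - U a = \<phi> i * (b - a)" if "\<tau> i \<le> a" "a \<le> b" "b \<le> \<tau> (Suc i)" for a b i
  proof -
    have "U b - U a = integral {a..b} (\<lambda>s. \<phi> (grid_index \<tau> s))"
      unfolding U_def using that time_grid_nonneg[OF \<tau>, of i]
      by (intro primitive_on_diff[OF primitive_on_grid_function[OF \<tau>], where b=b]) auto
    then show ?thesis using grid_function_integral[OF \<tau> that] by simp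
  qed
  \<comment> \<open>A potential that decreases along the grid; its last term is a credit of
    \<open>\<Delta>u / 2\<close> held on stable cells. An unstable cell of length \<open>L\<close>
    gains at most \<open>L - \<theta> * L \<le> L / 2 \<le> \<Delta>u / 2\<close>, which is offset
    by the credit of the stable cell that follows. A stable cell loses
    \<open>\<theta> * L \<ge> \<theta> * \<delta> = \<Delta>u / 2\<close>, enough to give up its
    credit.\<close>
  define q where "q i = U (\<tau> i) - \<theta> * \<tau> i - (if \<phi> i = 1 then 0 else \<Delta>u / 2)" for i
  have "q (Suc i) \<le> q i" for i
  proof -
    define L where "L = \<tau> (Suc i) - \<tau> i"
    have UL: "U (\<tau> (Suc i)) = U (\<tau> i) + \<phi> i * L"
      using U[of i "\<tau> i" "\<tau> (Suc i)"] time_grid_mono[OF \<tau>, of i "Suc i"] by (simp add: L_def)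
    have \<tau>L: "\<tau> (Suc i) = \<tau> i + L" by (simp add: L_def)
    have L: "\<theta> * L \<ge> \<Delta>u / 2" "\<theta> * L \<ge> 1 / 2 * L"
      using mult_left_mono[OF len(1)[of i], of \<theta>] mult_right_mono[OF \<theta>(1), of L] \<theta> len(1)[of i] \<delta>
      by (auto simp: L_def)
    have "q i - q (Suc i) = \<theta> * L - \<phi> i * L
        + (if \<phi> (Suc i) = 1 then 0 else \<Delta>u / 2) - (if \<phi> i = 1 then 0 else \<Delta>u / 2)"
      unfolding q_def UL unfolding \<tau>L by (simp add: algebra_simps)
    also have "\<dots> \<ge> 0"
    proof (cases "\<phi> i = 1")
      case True
      then show ?thesis using alt[OF True] len(3)[OF True] L by (simp add: L_def)
    next
      case False
      then have "\<phi> i = 0" using \<phi>[of i] by auto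
      then show ?thesis using L \<delta> by auto
    qed
    finally show ?thesis by simp
  qed
  then have q: "q j \<le> q i" if "i \<le> j" for i j
    using that by (rule lift_Suc_antimono_le)
  define i j where "i = grid_index \<tau> s" and "j = grid_index \<tau> t"
  have ij: "i \<le> j" unfolding i_def j_def using \<tau> st(2) by (rule grid_index_mono)
  have s: "\<tau> i \<le> s" "s < \<tau> (Suc i)" and t: "\<tau> j \<le> t" "t < \<tau> (Suc j)"
    using grid_index_le[OF \<tau>] grid_index_less[OF \<tau>] st by (auto simp: i_def j_def)
  have "U t - U (\<tau> j) \<le> \<Delta>u"
    using U[of j "\<tau> j" t] t \<phi>[of j] len(3)[of j] \<delta> by auto
  moreover have "\<theta> * \<tau> j \<le> \<theta> * t"
    using t \<theta> by (intro mult_left_mono) auto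
  ultimately have "U t - \<theta> * t \<le> q j + \<Delta>u / 2 + \<Delta>u"
    using \<delta> unfolding q_def by (auto split: if_splits)
  also have "q j \<le> q i" using ij by (rule q)
  finally have "U t - \<theta> * t \<le> q i + \<Delta>u / 2 + \<Delta>u" by simp
  moreover have "q i - \<theta> * \<Delta> \<le> U s - \<theta> * s"
  proof -
    have "U (\<tau> i) \<le> U s"
      using U[of i "\<tau> i" s] s \<phi>[of i] by auto
    moreover have "\<theta> * s \<le> \<theta> * (\<tau> i + \<Delta>)"
      using s len(2)[of i] \<theta> by (intro mult_left_mono) auto
    moreover have "q i \<le> U (\<tau> i) - \<theta> * \<tau> i"
      using \<delta> by (simp add: q_def)
    ultimately show ?thesis by (simp add: algebra_simps)
  qed
  \<comment> \<open>The incomplete cell at \<open>t\<close> costs \<open>\<Delta>u\<close>, the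
    credit \<open>\<Delta>u / 2\<close> and the incomplete cell at \<open>s\<close> costs
    \<open>\<theta> * \<Delta>\<close>; the first two are rounded up to
    \<open>2 * \<Delta>u\<close>.\<close>
  ultimately have "U t - U s \<le> \<theta> * (t - s) + (2 * \<Delta>u + \<theta> * \<Delta>)"
    using \<delta> by (simp add: algebra_simps)
  then show ?thesis by (simp add: \<theta>_def)
qed

text \<open>Even indices start the phases of length \<open>a\<close>, odd ones those of length
  \<open>b\<close>, so that the mode of the estimator is the parity of the cell number.\<close>

definition alternating_grid :: "real \<Rightarrow> real \<Rightarrow> nat \<Rightarrow> real" where
  "alternating_grid a b n = real (n div 2) * (a + b) + (if odd n then a else 0)"

lemma alternating_grid_simps:
  "alternating_grid a b (2 * k) = real k * (a + b)"
  "alternating_grid a b (Suc (2 * k)) = real k * (a + b) + a"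
  "alternating_grid a b (Suc (Suc (2 * k))) = real (Suc k) * (a + b)"
  by (simp_all add: alternating_grid_def)

lemma alternating_grid_Suc:
  "alternating_grid a b (Suc n) = alternating_grid a b n + (if odd n then b else a)"
proof (cases "even n")
  case True
  then obtain k where "n = 2 * k" by (elim evenE)
  then show ?thesis by (simp only: alternating_grid_simps) simp
next
  case False
  then obtain k where "n = Suc (2 * k)" by (auto elim: oddE)
  then show ?thesis by (simp only: alternating_grid_simps) (simp add: algebra_simps)
qed

lemma alternating_grid_time_grid:
  assumes "0 < a" "0 < b"
  shows "time_grid (alternating_grid a b)"
  unfolding time_grid_def
proof (intro conjI)
  show "strict_mono (alternating_grid a b)"
  proof (rule strict_monoI_Suc)
    show "alternating_grid a b n < alternating_grid a b (Suc n)" for n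
      using assms by (simp add: alternating_grid_Suc)
  qed
  have "min a b * real n \<le> alternating_grid a b n" for n
  proof (induction n)
    case (Suc n)
    have "min a b + alternating_grid a b n \<le> alternating_grid a b (Suc n)"
      by (simp add: alternating_grid_Suc)
    then show ?case using Suc by (simp add: algebra_simps)
  qed (simp add: alternating_grid_def)
  moreover have "filterlim (\<lambda>n. min a b * real n) at_top sequentially"
    using assms by (intro filterlim_tendsto_pos_mult_at_top[OF tendsto_const] filterlim_real_sequentially) auto
  ultimately show "filterlim (alternating_grid a b) at_top sequentially"
    by (rule filterlim_at_top_mono[OF _ always_eventually, rotated, rule_format])
qed (simp add: alternating_grid_def)

text \<open>With \<theta> = \<open>b / (a + b)\<close>, the difference vanishes at multiples of the
  period. Within a period it falls to - \<theta> \<open>a\<close> during the first phase and returns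
  to 0 during the second, and \<theta> \<open>a\<close> is at most \<open>b\<close>. Both signs are
  used: the upper estimate for the decay of the estimator, the lower one to dominate the
  subsystems.\<close>

lemma alternating_activation_time:
  assumes ab: "0 < a" "0 < b" and t: "0 \<le> t"
  shows "\<bar>integral {0..t} (\<lambda>s. of_bool (odd (grid_index (alternating_grid a b) s)))
      - b / (a + b) * t\<bar> \<le> b"
proof -
  define \<theta> where "\<theta> = b / (a + b)"
  have \<theta>: "0 \<le> \<theta>" "\<theta> * a + \<theta> * b = b"
    using ab by (simp_all add: \<theta>_def flip: distrib_left add_divide_distrib)
  define \<phi> :: "nat \<Rightarrow> real" where "\<phi> n = of_bool (odd n)" for n
  let ?\<tau> = "alternating_grid a b"
  have \<tau>: "time_grid ?\<tau>" using ab by (rule alternating_grid_time_grid)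
  define Z where "Z t = integral {0..t} (\<lambda>s. \<phi> (grid_index ?\<tau> s))" for t
  have Z: "Z d - Z c = \<phi> i * (d - c)" if "?\<tau> i \<le> c" "c \<le> d" "d \<le> ?\<tau> (Suc i)" for c d i
  proof -
    have "Z d - Z c = integral {c..d} (\<lambda>s. \<phi> (grid_index ?\<tau> s))"
      unfolding Z_def using that time_grid_nonneg[OF \<tau>, of i]
      by (intro primitive_on_diff[OF primitive_on_grid_function[OF \<tau>], where b=d]) auto
    then show ?thesis using grid_function_integral[OF \<tau> that] by simp
  qed
  have step: "Z (?\<tau> (Suc i)) = Z (?\<tau> i) + \<phi> i * (?\<tau> (Suc i) - ?\<tau> i)" for i
    using Z[of i "?\<tau> i" "?\<tau> (Suc i)"] time_grid_mono[OF \<tau>, of i "Suc i"] by simp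
  have Zk: "Z (real k * (a + b)) = real k * b" for k
  proof (induction k)
    case (Suc k)
    then show ?case
      using step[of "2 * k", unfolded alternating_grid_simps]
        step[of "Suc (2 * k)", unfolded alternating_grid_simps]
      by (simp add: \<phi>_def algebra_simps)
  qed (simp add: Z_def)
  define n where "n = grid_index ?\<tau> t"
  have n: "?\<tau> n \<le> t" "t < ?\<tau> (Suc n)"
    using grid_index_le[OF \<tau> t] grid_index_less[OF \<tau>] by (auto simp: n_def)
  have \<theta>k: "\<theta> * (real k * (a + b)) = real k * b" for k
    using \<theta>(2) by (metis distrib_left mult.left_commute)
  have "\<bar>Z t - \<theta> * t\<bar> \<le> b"
  proof (cases "even n")
    case True
    then obtain k where k: "n = 2 * k" by (elim evenE)
    define w where "w = t - real k * (a + b)"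
    have w: "0 \<le> w" "w \<le> a" using n by (auto simp: w_def k alternating_grid_simps)
    have "Z t = real k * b"
      using Z[of n "?\<tau> n" t] n by (simp add: k alternating_grid_simps \<phi>_def Zk)
    moreover have "\<theta> * t = real k * b + \<theta> * w"
      unfolding w_def right_diff_distrib \<theta>k by simp
    moreover have "\<theta> * w \<le> \<theta> * a" "0 \<le> \<theta> * w" "0 \<le> \<theta> * b"
      using w \<theta> ab by (auto intro: mult_left_mono)
    ultimately show ?thesis using \<theta> by simp
  next
    case False
    then obtain k where k: "n = Suc (2 * k)" by (auto elim: oddE)
    define w where "w = t - real k * (a + b) - a"
    have w: "0 \<le> w" "w \<le> b"
      using n[unfolded k alternating_grid_simps] by (auto simp: w_def distrib_right)
    have "Z t = real k * b + w"
      using Z[of n "?\<tau> n" t] n step[of "2 * k"] by (simp add: k alternating_grid_simps \<phi>_def Zk w_def)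
    moreover have "\<theta> * t = real k * b + \<theta> * a + \<theta> * w"
      unfolding w_def right_diff_distrib \<theta>k by simp
    moreover have "\<theta> * w \<le> \<theta> * b" "0 \<le> \<theta> * w" "0 \<le> \<theta> * a"
      using w \<theta> ab by (auto intro: mult_left_mono)
    ultimately show ?thesis using \<theta> w by linarith
  qed
  then show ?thesis by (simp add: Z_def \<theta>_def \<phi>_def)
qed

section \<open>Comparison functions\<close>

lemma class_K_nonneg: "class_K \<alpha> \<Longrightarrow> 0 \<le> r \<Longrightarrow> 0 \<le> \<alpha> r"
  unfolding class_K_def
  using strict_mono_on_leD[of "{0..}" \<alpha> 0 r] by auto

lemma class_K_mono: "class_K \<alpha> \<Longrightarrow> 0 \<le> r \<Longrightarrow> r \<le> s \<Longrightarrow> \<alpha> r \<le> \<alpha> s"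
  unfolding class_K_def using strict_mono_on_leD[of "{0..}" \<alpha> r s] by auto

lemma class_K_strict_mono: "class_K \<alpha> \<Longrightarrow> 0 \<le> r \<Longrightarrow> r < s \<Longrightarrow> \<alpha> r < \<alpha> s"
  unfolding class_K_def using strict_mono_onD[of "{0..}" \<alpha> r s] by auto

lemma class_K_le_iff: "class_K \<alpha> \<Longrightarrow> 0 \<le> r \<Longrightarrow> 0 \<le> s \<Longrightarrow> \<alpha> r \<le> \<alpha> s \<longleftrightarrow> r \<le> s"
  using class_K_mono[of \<alpha> r s] class_K_strict_mono[of \<alpha> s r] by force

lemma class_Kinf_class_K: "class_Kinf \<alpha> \<Longrightarrow> class_K \<alpha>"
  by (simp add: class_Kinf_def)

lemma class_Kinf_ident: "class_Kinf (\<lambda>r. r)"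
  by (simp add: class_Kinf_def class_K_def strict_mono_on_def filterlim_ident)

lemma class_Kinf_scaled_sum:
  assumes "class_Kinf \<gamma>1" "class_Kinf \<gamma>2" "0 < c"
  shows "class_Kinf (\<lambda>r. c * (\<gamma>1 r + \<gamma>2 r))"
proof -
  have "continuous_on {0..} (\<lambda>r. c * (\<gamma>1 r + \<gamma>2 r))"
    using assms by (intro continuous_intros) (auto simp: class_Kinf_def class_K_def)
  moreover have "strict_mono_on {0..} (\<lambda>r. c * (\<gamma>1 r + \<gamma>2 r))"
    using assms class_K_strict_mono[OF class_Kinf_class_K]
    by (intro strict_mono_onI) (auto intro!: add_strict_mono)
  moreover have "filterlim (\<lambda>r. c * (\<gamma>1 r + \<gamma>2 r)) at_top at_top"
    using assms
    by (intro filterlim_tendsto_pos_mult_at_top[OF tendsto_const] filterlim_at_top_add_at_top)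
      (auto simp: class_Kinf_def)
  ultimately show ?thesis
    using assms by (simp add: class_Kinf_def class_K_def)
qed

lemma class_Kinf_compose_scale:
  assumes "class_Kinf \<alpha>" "0 < c"
  shows "class_Kinf (\<lambda>r. \<alpha> (c * r))"
proof -
  have "continuous_on {0..} (\<lambda>r. \<alpha> (c * r))"
    using assms
    by (intro continuous_on_compose2[of "{0..}" \<alpha> "{0..}" "\<lambda>r. c * r"] continuous_intros)
      (auto simp: class_Kinf_def class_K_def)
  moreover have "strict_mono_on {0..} (\<lambda>r. \<alpha> (c * r))"
    using assms class_K_strict_mono[OF class_Kinf_class_K]
    by (intro strict_mono_onI) auto
  moreover have "filterlim (\<lambda>r. c * r) at_top at_top"
    using assms by (intro filterlim_tendsto_pos_mult_at_top[OF tendsto_const] filterlim_ident) auto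
  then have "filterlim (\<lambda>r. \<alpha> (c * r)) at_top at_top"
    using assms by (auto simp: class_Kinf_def intro: filterlim_compose[of \<alpha>])
  ultimately show ?thesis
    using assms by (simp add: class_Kinf_def class_K_def)
qed

text \<open>Unboundedness and the intermediate value theorem give surjectivity onto the half-line.
  Continuity of the inverse is a local matter and is taken from the compact intervals
  \<open>{0..M}\<close>, on which an injective continuous map has a continuous inverse.\<close>

lemma class_Kinf_inverse:
  assumes \<alpha>: "class_Kinf \<alpha>"
  obtains \<kappa> where "class_Kinf \<kappa>" "\<And>r. 0 \<le> r \<Longrightarrow> \<kappa> (\<alpha> r) = r"
    "\<And>y. 0 \<le> y \<Longrightarrow> 0 \<le> \<kappa> y" "\<And>y. 0 \<le> y \<Longrightarrow> \<alpha> (\<kappa> y) = y"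
proof -
  note K = class_Kinf_class_K[OF \<alpha>]
  have \<alpha>0: "\<alpha> 0 = 0" and cont: "continuous_on {0..} \<alpha>"
    using K by (auto simp: class_K_def)
  have "\<exists>r\<ge>0. \<alpha> r = y" if y: "0 \<le> y" for y
  proof -
    have "\<forall>\<^sub>F r in at_top. 0 \<le> r \<and> y \<le> \<alpha> r"
      using \<alpha> by (auto simp: class_Kinf_def filterlim_at_top eventually_conj_iff eventually_ge_at_top)
    then obtain b where "0 \<le> b" "y \<le> \<alpha> b"
      by (auto simp: eventually_at_top_linorder)
    then show ?thesis
      using IVT'[of \<alpha> 0 y b] y \<alpha>0 continuous_on_subset[OF cont, of "{0..b}"] by auto
  qed
  then obtain \<kappa> where \<kappa>: "0 \<le> \<kappa> y" "\<alpha> (\<kappa> y) = y" if "0 \<le> y" for y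
    by metis
  have inv: "\<kappa> (\<alpha> r) = r" if "0 \<le> r" for r
    using \<kappa>[of "\<alpha> r"] class_K_nonneg[OF K that] class_K_le_iff[OF K, of "\<kappa> (\<alpha> r)" r]
      class_K_le_iff[OF K, of r "\<kappa> (\<alpha> r)"] that by auto
  have mono: "\<kappa> y < \<kappa> w" if "0 \<le> y" "y < w" for y w
    using \<kappa>[of y] \<kappa>[of w] that class_K_le_iff[OF K, of "\<kappa> w" "\<kappa> y"] by auto
  have "continuous (at y within {0..}) \<kappa>" if y: "0 \<le> y" for y
  proof -
    \<comment> \<open>The summand 1 puts \<open>y\<close> strictly below \<open>\<alpha> M\<close>,
      so that \<open>{0..\<alpha> M}\<close> is a neighbourhood of \<open>y\<close> within the
      half-line.\<close>
    define M where "M = \<kappa> y + 1"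
    have M: "0 \<le> M" "y < \<alpha> M"
      using \<kappa>[OF y] class_K_strict_mono[OF K, of "\<kappa> y" M] by (auto simp: M_def)
    have "\<alpha> ` {0..M} = {0..\<alpha> M}"
    proof
      show "\<alpha> ` {0..M} \<subseteq> {0..\<alpha> M}"
        using class_K_nonneg[OF K] class_K_mono[OF K] by auto
      show "{0..\<alpha> M} \<subseteq> \<alpha> ` {0..M}"
      proof
        fix w assume "w \<in> {0..\<alpha> M}"
        then show "w \<in> \<alpha> ` {0..M}"
          using \<kappa>[of w] class_K_le_iff[OF K, of "\<kappa> w" M] M by (intro image_eqI[of _ _ "\<kappa> w"]) auto
      qed
    qed
    moreover have "continuous_on (\<alpha> ` {0..M}) \<kappa>"
      by (rule continuous_on_inv) (use continuous_on_subset[OF cont] inv in auto)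
    ultimately have "continuous (at y within {0..\<alpha> M}) \<kappa>"
      using y M by (auto simp: continuous_on_eq_continuous_within)
    moreover have "at y within {0..\<alpha> M} = at y within {0..}"
      using M by (intro at_within_nhd[of y "{..<\<alpha> M}"]) auto
    ultimately show ?thesis by simp
  qed
  then have "continuous_on {0..} \<kappa>"
    by (simp add: continuous_on_eq_continuous_within)
  moreover have "strict_mono_on {0..} \<kappa>"
    using mono by (intro strict_mono_onI) auto
  moreover have "\<kappa> 0 = 0" using inv[of 0] \<alpha>0 by simp
  moreover have "filterlim \<kappa> at_top at_top"
    unfolding filterlim_at_top
  proof
    fix Z
    have "Z \<le> \<kappa> y" if "\<alpha> (max Z 0) \<le> y" for y
    proof -
      have "0 \<le> y" using class_K_nonneg[OF K, of "max Z 0"] that by simp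
      then have "max Z 0 \<le> \<kappa> y"
        using class_K_le_iff[OF K, of "max Z 0" "\<kappa> y"] \<kappa>[of y] that by simp
      then show ?thesis by simp
    qed
    then show "\<forall>\<^sub>F y in at_top. Z \<le> \<kappa> y"
      unfolding eventually_at_top_linorder by blast
  qed
  ultimately have "class_Kinf \<kappa>"
    by (simp add: class_Kinf_def class_K_def)
  then show ?thesis using that inv \<kappa> by blast
qed

text \<open>Covers both class KL functions of the proof: with two identities for the estimator
  itself, and with the inverse of the lower bound of \<open>V\<close> and its upper bound for the
  state.\<close>

lemma class_KL_exp_decay:
  assumes a: "class_K \<alpha>1" "class_K \<alpha>2" and "0 < c" "0 < k"
  shows "class_KL (\<lambda>r t. \<alpha>1 (c * exp (- k * t) * \<alpha>2 r))"
  unfolding class_KL_def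
proof (intro conjI allI impI)
  have c: "continuous_on {0..} \<alpha>1" "continuous_on {0..} \<alpha>2"
    using a by (auto simp: class_K_def)
  have c2: "continuous_on ({0..} \<times> {0..}) (\<lambda>p::real \<times> real. \<alpha>2 (fst p))"
    by (rule continuous_on_compose2[OF c(2) continuous_on_fst[OF continuous_on_id]]) auto
  have nonneg: "0 \<le> c * exp (- k * t) * \<alpha>2 r" if "0 \<le> r" for r t
    using assms class_K_nonneg[OF a(2) that] by simp
  have "continuous_on ({0..} \<times> {0..}) (\<lambda>p. c * exp (- k * snd p) * \<alpha>2 (fst p))"
    by (intro continuous_intros c2)
  then have "continuous_on ({0..} \<times> {0..}) (\<lambda>p. \<alpha>1 (c * exp (- k * snd p) * \<alpha>2 (fst p)))"
    by (rule continuous_on_compose2[OF c(1)]) (use nonneg in auto)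
  then show "continuous_on ({0..} \<times> {0..}) (\<lambda>(r, t). \<alpha>1 (c * exp (- k * t) * \<alpha>2 r))"
    by (simp add: case_prod_unfold)
  show "class_K (\<lambda>r. \<alpha>1 (c * exp (- k * t) * \<alpha>2 r))" for t
    unfolding class_K_def
  proof (intro conjI)
    show "continuous_on {0..} (\<lambda>r. \<alpha>1 (c * exp (- k * t) * \<alpha>2 r))"
      by (rule continuous_on_compose2[OF c(1) continuous_on_mult_left[OF c(2)]]) (use nonneg in auto)
    show "strict_mono_on {0..} (\<lambda>r. \<alpha>1 (c * exp (- k * t) * \<alpha>2 r))"
    proof (rule strict_mono_onI)
      show "\<alpha>1 (c * exp (- k * t) * \<alpha>2 r) < \<alpha>1 (c * exp (- k * t) * \<alpha>2 s)"
        if "r \<in> {0..}" "r < s" for r s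
        using that assms class_K_strict_mono[OF a(2), of r s] nonneg
        by (intro class_K_strict_mono[OF a(1)]) auto
    qed
  qed (use a in \<open>simp add: class_K_def\<close>)
next
  fix r :: real assume r: "0 \<le> r"
  note nn = class_K_nonneg[OF a(2) r]
  show "antimono_on {0..} (\<lambda>t. \<alpha>1 (c * exp (- k * t) * \<alpha>2 r))"
    using assms nn
    by (intro monotone_onI class_K_mono[OF a(1)] mult_right_mono mult_left_mono) auto
  have "((\<lambda>t. exp (- (k * t))) \<longlongrightarrow> 0) at_top"
    using assms
    by (intro filterlim_compose[OF exp_at_bot] filterlim_uminus_at_bot_at_top[THEN filterlim_compose]
        filterlim_tendsto_pos_mult_at_top[OF tendsto_const] filterlim_ident) auto
  then have "((\<lambda>t. c * exp (- k * t) * \<alpha>2 r) \<longlongrightarrow> 0) at_top"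
    by (auto intro: tendsto_mult_left_zero tendsto_mult_right_zero)
  then have "((\<lambda>t. \<alpha>1 (c * exp (- k * t) * \<alpha>2 r)) \<longlongrightarrow> \<alpha>1 0) at_top"
    using a assms nn
    by (intro continuous_on_tendsto_compose[of "{0..}" \<alpha>1]) (auto simp: class_K_def)
  then show "((\<lambda>t. \<alpha>1 (c * exp (- k * t) * \<alpha>2 r)) \<longlongrightarrow> 0) at_top"
    using a by (simp add: class_K_def)
qed

text \<open>A substitute for subadditivity: \<open>p + q\<close> is at most the larger of
  \<open>2 * p\<close> and \<open>2 * q\<close>, and the value of \<kappa> there is one of the two
  summands.\<close>

lemma class_Kinf_inverse_le_add:
  assumes \<alpha>: "class_K \<alpha>" and \<kappa>: "class_K \<kappa>" "\<And>r. 0 \<le> r \<Longrightarrow> \<kappa> (\<alpha> r) = r"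
    and "0 \<le> r" "0 \<le> p" "0 \<le> q" "\<alpha> r \<le> p + q"
  shows "r \<le> \<kappa> (2 * p) + \<kappa> (2 * q)"
proof -
  have "r = \<kappa> (\<alpha> r)" using assms by simp
  also have "\<dots> \<le> \<kappa> (max (2 * p) (2 * q))"
    using assms by (intro class_K_mono[OF \<kappa>(1)] class_K_nonneg[OF \<alpha>]) auto
  also have "\<dots> \<le> \<kappa> (2 * p) + \<kappa> (2 * q)"
    using class_K_nonneg[OF \<kappa>(1), of "2 * p"] class_K_nonneg[OF \<kappa>(1), of "2 * q"] assms
    by (auto simp: max_def)
  finally show ?thesis .
qed

section \<open>Comparison along a switched trajectory\<close>

text \<open>\<open>A\<close> jumps at the switches and is therefore no indefinite integral. It is
  split into the continuous part \<open>R\<close>, to which the comparison on a single cell applies,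
  and the constant weight \<open>c i\<close>, which is \<mu> to the power \<open>- i\<close>. The
  identity \<open>c (Suc i) * \<mu> = c i\<close> cancels the factor lost in \<open>jump\<close>, so
  the estimates of consecutive cells add up.\<close>

lemma switched_lyapunov_comparison:
  fixes x :: "real \<Rightarrow> 'a::euclidean_space" and V :: "nat \<Rightarrow> 'a \<Rightarrow> real" and \<rho> :: "nat \<Rightarrow> real"
  assumes \<tau>: "time_grid \<tau>" and x: "primitive_on 0 t F x" and t: "0 \<le> t"
    and V: "\<And>i. continuously_differentiable (V i)" and \<mu>: "0 < \<mu>"
    and le: "\<And>s. s \<in> {0..t} \<Longrightarrow> frechet_derivative (V (grid_index \<tau> s)) (at (x s)) (F s)
        \<le> \<rho> (grid_index \<tau> s) * V (grid_index \<tau> s) (x s) + u s"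
    and jump: "\<And>i \<xi>. V (Suc i) \<xi> \<le> \<mu> * V i \<xi>"
    and u: "u absolutely_integrable_on {0..t}"
  defines "A \<equiv> \<lambda>s. integral {0..s} (\<lambda>s. \<rho> (grid_index \<tau> s)) + real (grid_index \<tau> s) * ln \<mu>"
  shows "(\<lambda>s. exp (- A s) * u s) absolutely_integrable_on {0..t}"
    and "exp (- A t) * V (grid_index \<tau> t) (x t) \<le> V 0 (x 0) + integral {0..t} (\<lambda>s. exp (- A s) * u s)"
proof -
  define R where "R s = integral {0..s} (\<lambda>s. \<rho> (grid_index \<tau> s))" for s
  define c where "c i = exp (- (real i * ln \<mu>))" for i
  have c: "0 < c i" "c (Suc i) * \<mu> = c i" "c 0 = 1" for i
    using \<mu> by (auto simp: c_def distrib_right exp_diff exp_minus exp_add inverse_eq_divide)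
  have R: "primitive_on 0 t (\<lambda>s. \<rho> (grid_index \<tau> s)) R"
    unfolding R_def by (rule primitive_on_grid_function[OF \<tau>])
  have cR: "continuous_on {0..t} R"
    using R by (rule primitive_on_continuous)
  define E where "E s = exp (- A s) * u s" for s
  have E: "E s = exp (- R s) * (c (grid_index \<tau> s) * u s)" for s
    by (simp add: E_def A_def R_def c_def exp_diff exp_minus exp_add divide_inverse mult.assoc)
  have "(\<lambda>s. exp (- R s) * (c (grid_index \<tau> s) * u s)) absolutely_integrable_on {0..t}"
    by (intro continuous_times_absolutely_integrable continuous_intros cR
        grid_function_times_absolutely_integrable[OF \<tau> u])
  then have Eai: "E absolutely_integrable_on {0..t}"
    by (simp add: E[abs_def])
  then show "(\<lambda>s. exp (- A s) * u s) absolutely_integrable_on {0..t}"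
    by (simp add: E_def[abs_def])
  \<comment> \<open>The right end \<open>\<tau> (Suc i)\<close> is included although it belongs to
    the next cell: \<open>V i\<close> at this point is the value just before the switch, to which
    \<open>jump\<close> refers.\<close>
  have step: "exp (- R s) * c i * V i (x s) \<le> exp (- R (\<tau> i)) * c i * V i (x (\<tau> i)) + integral {\<tau> i..s} E"
    if s: "\<tau> i \<le> s" "s \<le> \<tau> (Suc i)" "s \<le> t" for i s
  proof -
    have \<tau>i: "0 \<le> \<tau> i" using \<tau> by (rule time_grid_nonneg)
    have gi: "grid_index \<tau> r = i" if "r \<in> {\<tau> i..<s}" for r
      using that s by (intro grid_index_eq[OF \<tau>]) auto
    have "continuous_on {\<tau> i..s} (\<lambda>r. exp (- R r))"
      using continuous_on_subset[OF cR, of "{\<tau> i..s}"] \<tau>i s by (intro continuous_intros) auto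
    moreover have "u absolutely_integrable_on {\<tau> i..s}"
      using u \<tau>i s by (intro absolutely_integrable_on_subinterval[OF u]) auto
    ultimately have ui: "(\<lambda>r. exp (- R r) * u r) absolutely_integrable_on {\<tau> i..s}"
      by (rule continuous_times_absolutely_integrable)
    have "exp (- R s) * V i (x s) \<le> exp (- R (\<tau> i)) * V i (x (\<tau> i))
        + integral {\<tau> i..s} (\<lambda>r. exp (- R r) * u r)"
    proof (rule lyapunov_comparison[where r = "\<lambda>s. \<rho> (grid_index \<tau> s)" and F = F])
      show "primitive_on (\<tau> i) s F x" "primitive_on (\<tau> i) s (\<lambda>s. \<rho> (grid_index \<tau> s)) R"
        using primitive_on_subinterval[OF x] primitive_on_subinterval[OF R] \<tau>i s by auto
      show "frechet_derivative (V i) (at (x r)) (F r) \<le> \<rho> (grid_index \<tau> r) * V i (x r) + u r"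
        if "r \<in> {\<tau> i..<s}" for r
        using le[of r] gi[OF that] that \<tau>i s by auto
      show "(\<lambda>r. exp (- R r) * u r) integrable_on {\<tau> i..s}"
        using ui by (simp add: absolutely_integrable_on_def)
    qed (use s V in auto)
    then have "c i * (exp (- R s) * V i (x s)) \<le> c i * (exp (- R (\<tau> i)) * V i (x (\<tau> i))
        + integral {\<tau> i..s} (\<lambda>r. exp (- R r) * u r))"
      using c(1) by (intro mult_left_mono) (auto intro: less_imp_le)
    also have "\<dots> = c i * (exp (- R (\<tau> i)) * V i (x (\<tau> i)))
        + integral {\<tau> i..s} (\<lambda>r. c i * (exp (- R r) * u r))"
      by (simp add: distrib_left)
    also have "integral {\<tau> i..s} (\<lambda>r. c i * (exp (- R r) * u r)) = integral {\<tau> i..s} E"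
    proof (rule integral_spike[of "{s}"])
      show "E r = c i * (exp (- R r) * u r)" if "r \<in> {\<tau> i..s} - {s}" for r
        using gi[of r] that by (simp add: E)
    qed auto
    finally show ?thesis by (simp add: distrib_left mult_ac)
  qed
  have comb: "integral {0..\<tau> i} E + integral {\<tau> i..s} E = integral {0..s} E"
    if "\<tau> i \<le> s" "s \<le> t" for i s
    using that time_grid_nonneg[OF \<tau>, of i] absolutely_integrable_imp_integrable_subinterval(1)[OF Eai, of 0 s]
    by (intro Henstock_Kurzweil_Integration.integral_combine) auto
  have start: "exp (- R (\<tau> i)) * c i * V i (x (\<tau> i)) \<le> V 0 (x 0) + integral {0..\<tau> i} E"
    if "\<tau> i \<le> t" for i
    using that
  proof (induction i)
    case 0
    then show ?case using \<tau> by (simp add: time_grid_def R_def c)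
  next
    case (Suc i)
    have i: "\<tau> i \<le> \<tau> (Suc i)" using \<tau> by (rule time_grid_mono) simp
    have "exp (- R (\<tau> (Suc i))) * c (Suc i) * V (Suc i) (x (\<tau> (Suc i)))
        \<le> exp (- R (\<tau> (Suc i))) * c (Suc i) * (\<mu> * V i (x (\<tau> (Suc i))))"
      using jump c(1)[of "Suc i"] by (intro mult_left_mono) auto
    also have "\<dots> = exp (- R (\<tau> (Suc i))) * c i * V i (x (\<tau> (Suc i)))"
      by (simp only: c(2)[of i, symmetric] mult.assoc)
    also have "\<dots> \<le> exp (- R (\<tau> i)) * c i * V i (x (\<tau> i)) + integral {\<tau> i..\<tau> (Suc i)} E"
      using step[of i "\<tau> (Suc i)"] i Suc.prems by simp
    also have "\<dots> \<le> V 0 (x 0) + integral {0..\<tau> i} E + integral {\<tau> i..\<tau> (Suc i)} E"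
      using Suc.IH Suc.prems i by simp
    also have "\<dots> = V 0 (x 0) + integral {0..\<tau> (Suc i)} E"
      using comb[OF i] Suc.prems by simp
    finally show ?case .
  qed
  define i where "i = grid_index \<tau> t"
  have i: "\<tau> i \<le> t" "t \<le> \<tau> (Suc i)"
    using grid_index_le[OF \<tau> t] grid_index_less[OF \<tau>, of t] by (auto simp: i_def)
  have "exp (- R t) * c i * V i (x t) \<le> V 0 (x 0) + integral {0..t} E"
    using step[OF i order_refl] start[OF i(1)] comb[OF i(1) order_refl] by simp
  moreover have "exp (- A t) = exp (- R t) * c i"
    by (simp add: A_def R_def c_def i_def exp_diff exp_minus exp_add divide_inverse)
  ultimately show "exp (- A t) * V (grid_index \<tau> t) (x t)
      \<le> V 0 (x 0) + integral {0..t} (\<lambda>s. exp (- A s) * u s)"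
    by (simp add: i_def E_def[abs_def])
qed

text \<open>Multiplication by \<open>exp (A t)\<close> turns the hypothesis into a bound with the
  kernel \<open>exp (A t - A s)\<close>. As \<open>u\<close> and \<open>W0\<close> are nonnegative,
  it suffices to enlarge the kernel to \<open>exp (C + R t - R s)\<close>.\<close>

lemma drift_comparison:
  fixes A R u :: "real \<Rightarrow> real"
  assumes t: "0 \<le> t" and drift: "\<And>s. s \<in> {0..t} \<Longrightarrow> A t - A s \<le> R t - R s + C"
    and A0: "A 0 = 0" and R0: "R 0 = 0"
    and int: "(\<lambda>s. exp (- A s) * u s) integrable_on {0..t}" "(\<lambda>s. exp (- R s) * u s) integrable_on {0..t}"
    and u: "\<And>s. s \<in> {0..t} \<Longrightarrow> 0 \<le> u s" and W0: "0 \<le> W0"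
    and W: "exp (- A t) * W \<le> W0 + integral {0..t} (\<lambda>s. exp (- A s) * u s)"
  shows "W \<le> exp C * exp (R t) * (W0 + integral {0..t} (\<lambda>s. exp (- R s) * u s))"
proof -
  have "W = exp (A t) * (exp (- A t) * W)"
    by (simp add: exp_minus)
  also have "\<dots> \<le> exp (A t) * (W0 + integral {0..t} (\<lambda>s. exp (- A s) * u s))"
    using W by (intro mult_left_mono) auto
  also have "\<dots> = exp (A t) * W0 + integral {0..t} (\<lambda>s. exp (A t) * (exp (- A s) * u s))"
    by (simp add: distrib_left)
  also have "\<dots> \<le> exp (C + R t) * W0 + integral {0..t} (\<lambda>s. exp (C + R t) * (exp (- R s) * u s))"
  proof (intro add_mono integral_le mult_right_mono)
    show "exp (A t) \<le> exp (C + R t)" using drift[of 0] t A0 R0 by simp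
    fix s assume s: "s \<in> {0..t}"
    have "exp (A t - A s) * u s \<le> exp (C + R t - R s) * u s"
      using drift[OF s] u[OF s] by (intro mult_right_mono) auto
    then show "exp (A t) * (exp (- A s) * u s) \<le> exp (C + R t) * (exp (- R s) * u s)"
      by (simp add: exp_diff exp_minus field_simps)
  qed (use W0 int in \<open>auto intro: integrable_on_cmult_left simp: integrable_on_cmult_left_iff\<close>)
  also have "\<dots> = exp C * exp (R t) * (W0 + integral {0..t} (\<lambda>s. exp (- R s) * u s))"
    by (simp add: distrib_left exp_add)
  finally show ?thesis .
qed

section \<open>Essentially bounded inputs\<close>

lemma ess_norm_bound:
  assumes "ess_bounded {0..t} w"
  obtains N where "negligible N" "\<And>s. s \<in> {0..t} - N \<Longrightarrow> norm (w s) \<le> ess_norm {0..t} w"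
proof -
  let ?e = "esssup (lebesgue_on {0..t}) (\<lambda>s. ennreal (norm (w s)))"
  have "AE s in lebesgue_on {0..t}. ennreal (norm (w s)) \<le> ?e"
    by (rule esssup_AE)
  \<comment> \<open>Without finiteness \<open>enn2real\<close> would return 0 and the bound would be
    false.\<close>
  moreover have fin: "?e < \<infinity>" using assms by (simp add: ess_bounded_def)
  have "norm (w s) \<le> enn2real ?e" if "ennreal (norm (w s)) \<le> ?e" for s
    using enn2real_mono[OF that] fin by simp
  ultimately have "AE s in lebesgue_on {0..t}. norm (w s) \<le> ess_norm {0..t} w"
    unfolding ess_norm_def by (auto elim: eventually_mono)
  then have "AE s in lebesgue. s \<in> {0..t} \<longrightarrow> norm (w s) \<le> ess_norm {0..t} w"
    by (subst (asm) AE_restrict_space_iff) auto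
  then obtain N where "N \<in> null_sets lebesgue"
    "{s \<in> space lebesgue. \<not> (s \<in> {0..t} \<longrightarrow> norm (w s) \<le> ess_norm {0..t} w)} \<subseteq> N"
    by (auto simp: eventually_ae_filter)
  then show ?thesis
    by (intro that[of N]) (auto simp: negligible_iff_null_sets)
qed

text \<open>A class K function is controlled on the half-line only, but its composition with the
  norm is continuous on the whole space.\<close>

lemma class_K_norm_measurable:
  fixes w :: "'a \<Rightarrow> 'b::euclidean_space"
  assumes "class_K \<gamma>" "w \<in> borel_measurable M"
  shows "(\<lambda>s. \<gamma> (norm (w s))) \<in> borel_measurable M"
proof -
  have "continuous_on {0..} \<gamma>"
    using assms(1) by (simp add: class_K_def)
  then have "continuous_on UNIV (\<lambda>p::'b. \<gamma> (norm p))"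
    by (rule continuous_on_compose2[OF _ continuous_on_norm_id]) auto
  then show ?thesis
    using measurable_compose[OF assms(2) borel_measurable_continuous_onI] by simp
qed

lemma class_K_input_integrable:
  fixes v :: "real \<Rightarrow> 'a::euclidean_space" and y :: "real \<Rightarrow> 'b::euclidean_space"
  assumes \<gamma>: "class_K \<gamma>1" "class_K \<gamma>2" and w: "ess_bounded {0..t} (\<lambda>s. (v s, y s))"
  defines "u \<equiv> \<lambda>s. \<gamma>1 (norm (v s)) + \<gamma>2 (norm (y s))"
  defines "M \<equiv> ess_norm {0..t} (\<lambda>s. (v s, y s))"
  shows "u absolutely_integrable_on {0..t}"
    and "\<exists>N. negligible N \<and> (\<forall>s\<in>{0..t} - N. 0 \<le> u s \<and> u s \<le> \<gamma>1 M + \<gamma>2 M)"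
proof -
  obtain N where N: "negligible N" "\<And>s. s \<in> {0..t} - N \<Longrightarrow> norm (v s, y s) \<le> M"
    using ess_norm_bound[OF w] unfolding M_def by blast
  have M: "0 \<le> M" by (simp add: M_def ess_norm_def)
  have meas: "(\<lambda>s. (v s, y s)) \<in> borel_measurable (lebesgue_on {0..t})"
    using w by (simp add: ess_bounded_def)
  have "v \<in> borel_measurable (lebesgue_on {0..t})"
    using measurable_compose[OF meas borel_measurable_continuous_onI[OF continuous_on_fst[OF continuous_on_id]]]
    by simp
  moreover have "y \<in> borel_measurable (lebesgue_on {0..t})"
    using measurable_compose[OF meas borel_measurable_continuous_onI[OF continuous_on_snd[OF continuous_on_id]]]
    by simp
  ultimately have um: "u \<in> borel_measurable (lebesgue_on {0..t})"
    unfolding u_def using \<gamma> by (intro borel_measurable_add class_K_norm_measurable)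
  have nonneg: "0 \<le> u s" for s
    using class_K_nonneg[OF \<gamma>(1), of "norm (v s)"] class_K_nonneg[OF \<gamma>(2), of "norm (y s)"]
    by (simp add: u_def)
  have bound: "0 \<le> u s \<and> u s \<le> \<gamma>1 M + \<gamma>2 M" if "s \<in> {0..t} - N" for s
  proof -
    have "norm (v s) \<le> M" "norm (y s) \<le> M"
      using N(2)[OF that] norm_fst_le[of "v s" "y s"] norm_snd_le[of "y s" "v s"] by auto
    then show ?thesis
      using class_K_mono[OF \<gamma>(1), of "norm (v s)" M] class_K_mono[OF \<gamma>(2), of "norm (y s)" M] nonneg[of s]
      by (simp add: u_def)
  qed
  \<comment> \<open>The truncation is bounded at every point, hence integrable, and agrees with
    \<open>u\<close> off the null set \<open>N\<close>.\<close>
  define g where "g s = min (u s) (\<gamma>1 M + \<gamma>2 M)" for s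
  have "g absolutely_integrable_on {0..t}"
    using um class_K_nonneg[OF \<gamma>(1) M] class_K_nonneg[OF \<gamma>(2) M] nonneg
    by (intro measurable_bounded_by_integrable_imp_absolutely_integrable[of _ _ "\<lambda>_. \<gamma>1 M + \<gamma>2 M"])
      (auto simp: g_def[abs_def] intro!: borel_measurable_min)
  then show "u absolutely_integrable_on {0..t}"
    using N(1) by (rule absolutely_integrable_spike) (use bound in \<open>auto simp: g_def\<close>)
  show "\<exists>N. negligible N \<and> (\<forall>s\<in>{0..t} - N. 0 \<le> u s \<and> u s \<le> \<gamma>1 M + \<gamma>2 M)"
    using N(1) bound by blast
qed

section \<open>The estimator\<close>

lemma grid_integral_affine:
  fixes \<phi> :: "nat \<Rightarrow> real"
  assumes "time_grid \<tau>" "0 \<le> t"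
  shows "integral {0..t} (\<lambda>s. p + q * \<phi> (grid_index \<tau> s))
    = p * t + q * integral {0..t} (\<lambda>s. \<phi> (grid_index \<tau> s))"
proof -
  have "(\<lambda>s. \<phi> (grid_index \<tau> s)) integrable_on {0..t}"
    using grid_function_absolutely_integrable[OF assms(1), where \<rho> = \<phi> and a = 0 and b = t]
    by (simp add: absolutely_integrable_on_def)
  then have "((\<lambda>s. p + q * \<phi> (grid_index \<tau> s)) has_integral
      (t - 0) *\<^sub>R p + q * integral {0..t} (\<lambda>s. \<phi> (grid_index \<tau> s))) {0..t}"
    using has_integral_const_real[of p 0 t] assms(2)
    by (intro has_integral_add has_integral_mult_right integrable_integral) auto
  then show ?thesis
    by (simp add: integral_unique mult.commute)
qed

text \<open>Off \<open>N\<close> the equation is linear with rate \<open>\<rho>\<close>, so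
  variation of constants applies. The decay from time 0 bounds the influence of the initial state,
  the decay from all intermediate times the influence of the input, with the gain
  \<open>exp C / \<kappa>\<close>; the outer comparison function is the identity.\<close>

lemma grid_linear_iss:
  fixes G :: "real \<Rightarrow> real \<Rightarrow> 'm::euclidean_space \<Rightarrow> 'k::euclidean_space \<Rightarrow> real" and \<rho> :: "nat \<Rightarrow> real"
  assumes \<tau>: "time_grid \<tau>" and \<gamma>: "class_Kinf \<gamma>1" "class_Kinf \<gamma>2" and N: "negligible N"
    and G: "\<And>s z v y. 0 \<le> s \<Longrightarrow> s \<notin> N \<Longrightarrow>
      G s z v y = \<rho> (grid_index \<tau> s) * z + (\<gamma>1 (norm v) + \<gamma>2 (norm y))"
    and \<kappa>: "0 < \<kappa>"
    and decay: "\<And>s t. 0 \<le> s \<Longrightarrow> s \<le> t \<Longrightarrow>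
      integral {0..t} (\<lambda>r. \<rho> (grid_index \<tau> r)) - integral {0..s} (\<lambda>r. \<rho> (grid_index \<tau> r))
        \<le> C - \<kappa> * (t - s)"
  shows "iss_wrt_input_output G {0..}"
proof -
  define R where "R t = integral {0..t} (\<lambda>r. \<rho> (grid_index \<tau> r))" for t
  have R: "primitive_on 0 t (\<lambda>s. \<rho> (grid_index \<tau> s)) R" for t
    unfolding R_def by (rule primitive_on_grid_function[OF \<tau>])
  have R0: "R 0 = 0" by (simp add: R_def)
  note K = class_Kinf_class_K[OF \<gamma>(1)] class_Kinf_class_K[OF \<gamma>(2)]
  have claims: "(\<exists>z. caratheodory_solution T (\<lambda>s \<xi>. G s \<xi> (v s) (y s)) z0 z) \<and>
      (\<forall>z. caratheodory_solution T (\<lambda>s \<xi>. G s \<xi> (v s) (y s)) z0 z \<longrightarrow>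
        (\<forall>t\<ge>0. ereal t < T \<longrightarrow> norm (z t) \<le> exp C * exp (- \<kappa> * t) * norm z0
          + exp C / \<kappa> * (\<gamma>1 (ess_norm {0..t} (\<lambda>s. (v s, y s))) + \<gamma>2 (ess_norm {0..t} (\<lambda>s. (v s, y s))))))"
    if z0: "z0 \<in> {0..}" and vy: "\<forall>t\<ge>0. ereal t < T \<longrightarrow> ess_bounded {0..t} (\<lambda>s. (v s, y s))"
    for T z0 and v :: "real \<Rightarrow> 'm" and y :: "real \<Rightarrow> 'k"
  proof -
    define u where "u s = \<gamma>1 (norm (v s)) + \<gamma>2 (norm (y s))" for s
    have u0: "0 \<le> u s" for s
      using class_K_nonneg[OF K(1)] class_K_nonneg[OF K(2)] by (simp add: u_def)
    have Gu: "G s \<xi> (v s) (y s) = \<rho> (grid_index \<tau> s) * \<xi> + u s" if "0 \<le> s" "s \<notin> N" for s \<xi>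
      using G[OF that] by (simp add: u_def)
    have u: "u absolutely_integrable_on {0..t}" if "0 \<le> t" "ereal t < T" for t
      unfolding u_def using class_K_input_integrable(1)[OF K vy[rule_format, OF that]] .
    define z where "z t = exp (R t) * (z0 + integral {0..t} (\<lambda>s. exp (- R s) * u s))" for t
    have "caratheodory_solution T (\<lambda>s \<xi>. G s \<xi> (v s) (y s)) z0 z"
    proof (rule primitive_on_caratheodory_solution)
      fix t :: real assume t: "0 \<le> t" "ereal t < T"
      have "primitive_on 0 t (\<lambda>s. \<rho> (grid_index \<tau> s) * z s + u s) z"
        unfolding z_def by (rule linear_ode_exists[OF R u[OF t]])
      then show "primitive_on 0 t (\<lambda>s. G s (z s) (v s) (y s)) z"
        using N by (rule primitive_on_spike) (simp add: Gu)
    qed (simp add: z_def R0)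
    moreover have "norm (z t) \<le> exp C * exp (- \<kappa> * t) * norm z0
        + exp C / \<kappa> * (\<gamma>1 (ess_norm {0..t} (\<lambda>s. (v s, y s))) + \<gamma>2 (ess_norm {0..t} (\<lambda>s. (v s, y s))))"
      if z: "caratheodory_solution T (\<lambda>s \<xi>. G s \<xi> (v s) (y s)) z0 z" and t: "0 \<le> t" "ereal t < T" for z t
    proof -
      define M where "M = ess_norm {0..t} (\<lambda>s. (v s, y s))"
      have M: "0 \<le> M" by (simp add: M_def ess_norm_def)
      define I where "I = integral {0..t} (\<lambda>s. exp (- R s) * u s)"
      have "\<exists>N. negligible N \<and> (\<forall>s\<in>{0..t} - N. 0 \<le> u s \<and> u s \<le> \<gamma>1 M + \<gamma>2 M)"
        unfolding u_def M_def using class_K_input_integrable(2)[OF K vy[rule_format, OF t]] .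
      then obtain N' where N': "negligible N'" "\<And>s. s \<in> {0..t} - N' \<Longrightarrow> 0 \<le> u s \<and> u s \<le> \<gamma>1 M + \<gamma>2 M"
        by blast
      have "primitive_on 0 t (\<lambda>s. \<rho> (grid_index \<tau> s) * z s + u s) z"
        using caratheodory_solution_primitive_on(1)[OF z t] N
        by (rule primitive_on_spike) (simp add: Gu)
      then have "exp (- R t) * z t = z0 + I"
        using linear_ode_solution[OF _ R t(1), of z u] R0 caratheodory_solution_primitive_on(2)[OF z t]
        by (simp add: I_def)
      then have zt: "z t = exp (R t) * z0 + exp (R t) * I"
        by (simp add: exp_minus field_simps)
      have int: "(\<lambda>s. exp (- R s) * u s) integrable_on {0..t}"
        using continuous_times_absolutely_integrable[OF _ u[OF t], of "\<lambda>s. exp (- R s)"]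
          primitive_on_continuous[OF R, of t]
        by (simp add: absolutely_integrable_on_def continuous_on_exp continuous_on_minus)
      have "exp (R t) * I \<le> exp C * (\<gamma>1 M + \<gamma>2 M) / \<kappa>"
        unfolding I_def
        using t(1) \<kappa> _ _ int N'
        by (rule integral_exp_decay_le)
          (use class_K_nonneg[OF K(1) M] class_K_nonneg[OF K(2) M] decay in \<open>auto simp: R_def\<close>)
      \<comment> \<open>With \<open>z0 \<ge> 0\<close> this makes \<open>z t\<close> nonnegative, so
        that its norm is \<open>z t\<close> itself.\<close>
      moreover have "0 \<le> I"
        unfolding I_def using int u0 by (intro integral_nonneg) auto
      moreover have "exp (R t) * z0 \<le> exp (C - \<kappa> * t) * z0"
        using decay[of 0 t] t(1) z0 by (intro mult_right_mono) (auto simp: R_def)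
      moreover have "exp (C - \<kappa> * t) = exp C * exp (- \<kappa> * t)"
        by (simp flip: exp_add)
      ultimately show ?thesis
        using z0 unfolding zt M_def[symmetric] by simp
    qed
    ultimately show ?thesis by blast
  qed
  have "class_KL (\<lambda>r t. exp C * exp (- \<kappa> * t) * r)"
    using class_KL_exp_decay[of "\<lambda>r. r" "\<lambda>r. r" "exp C" \<kappa>] class_Kinf_class_K[OF class_Kinf_ident] \<kappa>
    by simp
  moreover have "class_Kinf (\<lambda>r. exp C / \<kappa> * (\<gamma>1 r + \<gamma>2 r))"
    using \<gamma> \<kappa> by (intro class_Kinf_scaled_sum) auto
  ultimately show ?thesis
    unfolding iss_wrt_input_output_def using class_Kinf_ident claims by blast
qed

text \<open>Here \<open>dU\<close>, \<open>dZ\<close> and \<open>dn\<close> are the increments of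
  the two activation times and of the number of switches over a time \<open>d\<close>, while
  \<open>a\<close>, \<open>b\<close> are the rates of the estimator. The coefficient
  \<open>ls + lu\<close> of \<open>dU\<close> is split into \<open>ls - a + lu - b\<close> and
  \<open>a + b\<close>. The first part, together with the switches, is absorbed by the surplus decay
  \<open>ls - a\<close> according to \<open>rate\<close>; the second part is bounded through
  \<open>dZ\<close> because \<open>\<theta> \<le> \<theta>z\<close>.\<close>

lemma drift_rate_estimate:
  fixes d :: real
  assumes "0 \<le> d" and U: "dU \<le> \<theta> * d + C1" and Z: "\<theta>z * d - C2 \<le> dZ" and n: "dn \<le> d / \<delta> + 1"
    and "\<theta> \<le> \<theta>z" "0 \<le> ln \<mu>" and ab: "0 \<le> a + b" "0 \<le> ls - a + lu - b"
    and rate: "ln \<mu> * (1 / \<delta>) - (ls - a) + (ls - a + lu - b) * \<theta> \<le> 0"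
  shows "- ls * d + (ls + lu) * dU + dn * ln \<mu>
    \<le> - a * d + (a + b) * dZ + ((ls - a + lu - b) * C1 + (a + b) * (C1 + C2) + ln \<mu>)"
proof -
  have "(ls - a + lu - b) * dU \<le> (ls - a + lu - b) * (\<theta> * d + C1)"
    using U ab(2) by (rule mult_left_mono)
  moreover have "\<theta> * d \<le> \<theta>z * d"
    using assms by (intro mult_right_mono) auto
  then have "(a + b) * (dU - dZ) \<le> (a + b) * (C1 + C2)"
    using U Z ab(1) by (intro mult_left_mono) auto
  moreover have "dn * ln \<mu> \<le> (d / \<delta> + 1) * ln \<mu>"
    using n assms by (intro mult_right_mono) auto
  moreover have "(ln \<mu> * (1 / \<delta>) - (ls - a) + (ls - a + lu - b) * \<theta>) * d \<le> 0"
    using rate assms(1) by (simp add: mult_nonpos_nonneg)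
  ultimately show ?thesis
    by (simp add: algebra_simps)
qed

lemma switching_instants_time_grid:
  "switching_instants \<sigma> \<tau> \<Longrightarrow> time_grid \<tau>"
  by (simp add: switching_instants_def time_grid_def)

lemma switching_instants_value:
  assumes "switching_instants \<sigma> \<tau>" "0 \<le> s"
  shows "\<sigma> s = \<sigma> (\<tau> (grid_index \<tau> s))"
proof -
  have \<tau>: "time_grid \<tau>" using assms(1) by (rule switching_instants_time_grid)
  have "s \<in> {\<tau> (grid_index \<tau> s)..<\<tau> (Suc (grid_index \<tau> s))}"
    using grid_index_le[OF \<tau> assms(2)] grid_index_less[OF \<tau>, of s] by simp
  then show ?thesis using assms(1) unfolding switching_instants_def by blast
qed

text \<open>The two definitions quantify over the switching instants separately; uniqueness of the
  instants merges their conditions into one sequence.\<close>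

lemma restricted_admissible_signals_cases:
  assumes "\<sigma> \<in> restricted_admissible_signals PS PU E \<delta> \<Delta> \<delta>s \<Delta>u"
  obtains \<tau> where "switching_instants \<sigma> \<tau>" "\<And>i. (\<sigma> (\<tau> i), \<sigma> (\<tau> (Suc i))) \<in> E"
    "\<And>i. \<sigma> (\<tau> i) \<in> PS \<union> PU" "\<And>i. \<delta> \<le> \<tau> (Suc i) - \<tau> i" "\<And>i. \<tau> (Suc i) - \<tau> i \<le> \<Delta>"
    "\<And>i. \<sigma> (\<tau> i) \<in> PU \<Longrightarrow> \<sigma> (\<tau> (Suc i)) \<notin> PU"
    "\<And>i. \<sigma> (\<tau> i) \<in> PU \<Longrightarrow> \<tau> (Suc i) - \<tau> i \<le> \<Delta>u"
proof -
  obtain \<tau>1 where P: "\<forall>t\<ge>0. \<sigma> t \<in> PS \<union> PU" and \<tau>1: "switching_instants \<sigma> \<tau>1"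
    "\<forall>i. (\<sigma> (\<tau>1 i), \<sigma> (\<tau>1 (Suc i))) \<in> E \<and> \<tau>1 (Suc i) - \<tau>1 i \<in> {\<delta>..\<Delta>}"
    using assms unfolding restricted_admissible_signals_def admissible_signals_def by blast
  obtain \<tau> where \<tau>: "switching_instants \<sigma> \<tau>"
    "\<forall>i. \<not> (\<sigma> (\<tau> i) \<in> PU \<and> \<sigma> (\<tau> (Suc i)) \<in> PU) \<and>
         (\<sigma> (\<tau> i) \<in> PU \<longrightarrow> \<tau> (Suc i) - \<tau> i \<in> {\<delta>..\<Delta>u})"
    using assms unfolding restricted_admissible_signals_def by blast
  have "\<tau>1 = \<tau>" using \<tau>1(1) \<tau>(1) by (rule switching_instants_unique)
  moreover have "\<sigma> (\<tau> i) \<in> PS \<union> PU" for i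
    using P time_grid_nonneg[OF switching_instants_time_grid[OF \<tau>(1)], of i] by blast
  ultimately show ?thesis
    using \<tau> \<tau>1 by (intro that[of \<tau>]) auto
qed

text \<open>The signal \<open>\<zeta>\<close> is left-continuous whereas functions of \<open>grid_index\<close> are right-continuous,
  hence the exception for the grid points.\<close>

lemma estimator_field_grid:
  fixes \<zeta> :: "real \<Rightarrow> nat"
  assumes ab: "0 < a" "0 < b"
    and \<zeta>0: "\<And>(k::nat) t. t \<in> {k * (a + b)<..k * (a + b) + a} \<Longrightarrow> \<zeta> t = 0"
    and \<zeta>1: "\<And>(k::nat) t. t \<in> {k * (a + b) + a<..(k + 1) * (a + b)} \<Longrightarrow> \<zeta> t = 1"
    and s: "0 \<le> s" "s \<notin> range (alternating_grid a b)"
  shows "estimator_field ls lu \<gamma>1 \<gamma>2 (\<zeta> s) z v y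
    = (- ls + (ls + lu) * of_bool (odd (grid_index (alternating_grid a b) s))) * z
      + (\<gamma>1 (norm v) + \<gamma>2 (norm y))"
proof -
  let ?\<tau> = "alternating_grid a b"
  have \<tau>: "time_grid ?\<tau>" using ab by (rule alternating_grid_time_grid)
  define n where "n = grid_index ?\<tau> s"
  have "?\<tau> n \<le> s" "s < ?\<tau> (Suc n)"
    using grid_index_le[OF \<tau> s(1)] grid_index_less[OF \<tau>, of s] by (auto simp: n_def)
  moreover have "?\<tau> n \<noteq> s" using s(2) by auto
  ultimately have n: "?\<tau> n < s" "s < ?\<tau> (Suc n)" by auto
  have "\<zeta> s = of_bool (odd n)"
  proof (cases "even n")
    case True
    then obtain k where k: "n = 2 * k" by (elim evenE)
    show ?thesis using \<zeta>0[of s k] n[unfolded k alternating_grid_simps] k by simp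
  next
    case False
    then obtain k where k: "n = Suc (2 * k)" by (auto elim: oddE)
    show ?thesis using \<zeta>1[of s k] n[unfolded k alternating_grid_simps] k by (simp add: add.commute)
  qed
  then show ?thesis by (simp add: estimator_field_def n_def)
qed

theorem theorem2:
  fixes N :: nat and PS PU :: "nat set" and E :: "(nat \<times> nat) set"
    and f :: "nat \<Rightarrow> real^'d \<Rightarrow> real^'m \<Rightarrow> real^'d"
    and h :: "nat \<Rightarrow> real^'d \<Rightarrow> real^'k"
    and V :: "nat \<Rightarrow> real^'d \<Rightarrow> real"
    and \<alpha>1 \<alpha>2 \<gamma>1 \<gamma>2 :: "real \<Rightarrow> real"
    and \<delta> \<Delta> lam_s lam_u \<mu> \<delta>s \<Delta>u lam_s' lam_u' \<delta>z \<Delta>z :: real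
    and \<zeta> :: "real \<Rightarrow> nat" and \<sigma> :: "real \<Rightarrow> nat"
  assumes partition: "PS \<union> PU = {1..N}" "PS \<inter> PU = {}"
    and f: "\<And>p. p \<in> {1..N} \<Longrightarrow> locally_lipschitz (\<lambda>(\<xi>, \<eta>). f p \<xi> \<eta>)"
      "\<And>p. p \<in> {1..N} \<Longrightarrow> f p 0 0 = 0"
    and h: "\<And>p. p \<in> {1..N} \<Longrightarrow> continuous_on UNIV (h p)"
      "\<And>p. p \<in> {1..N} \<Longrightarrow> h p 0 = 0"
    and E: "E \<subseteq> {(p, q). p \<in> {1..N} \<and> q \<in> {1..N} \<and> p \<noteq> q}"
    and dwell: "0 < \<delta>" "\<delta> \<le> \<Delta>"
    and A1: "class_Kinf \<alpha>1" "class_Kinf \<alpha>2" "class_Kinf \<gamma>1" "class_Kinf \<gamma>2"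
      "\<And>p. p \<in> {1..N} \<Longrightarrow> continuously_differentiable (V p)"
      "\<And>p \<xi>. p \<in> {1..N} \<Longrightarrow> 0 \<le> V p \<xi>"
      "0 < lam_s" "0 < lam_u"
      "\<And>p \<xi>. p \<in> {1..N} \<Longrightarrow> \<alpha>1 (norm \<xi>) \<le> V p \<xi> \<and> V p \<xi> \<le> \<alpha>2 (norm \<xi>)"
      "\<And>p \<xi> \<eta>. p \<in> PS \<Longrightarrow>
         frechet_derivative (V p) (at \<xi>) (f p \<xi> \<eta>)
           \<le> - lam_s * V p \<xi> + \<gamma>1 (norm \<eta>) + \<gamma>2 (norm (h p \<xi>))"
      "\<And>p \<xi> \<eta>. p \<in> PU \<Longrightarrow>
         frechet_derivative (V p) (at \<xi>) (f p \<xi> \<eta>)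
           \<le> lam_u * V p \<xi> + \<gamma>1 (norm \<eta>) + \<gamma>2 (norm (h p \<xi>))"
    and A2: "1 \<le> \<mu>" "\<And>p q \<xi>. (p, q) \<in> E \<Longrightarrow> V q \<xi> \<le> \<mu> * V p \<xi>"
    and A3: "\<And>p. p \<in> PU \<Longrightarrow> \<exists>q\<in>PS. (p, q) \<in> E"
    and A4: "\<delta>s \<in> {\<delta>..\<Delta>}" "\<Delta>u \<in> {\<delta>..\<Delta>}"
      "- lam_s * (\<delta>s / \<Delta>) + lam_s * (\<delta>s / (2 * \<delta>)) + lam_u * (\<Delta>u / (2 * \<delta>)) + ln \<mu> * (1 / \<delta>) < 0"
    and rates: "0 < lam_s'" "lam_s' < lam_s" "lam_u \<le> lam_u'" "0 \<le> lam_s - lam_s' + lam_u - lam_u'"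
      "- lam_s' * (\<delta>s / \<Delta>) + lam_s' * (\<delta>s / (2 * \<delta>)) + lam_u' * (\<Delta>u / (2 * \<delta>)) < 0"
      "ln \<mu> * (1 / \<delta>) - (lam_s - lam_s') + (lam_s - lam_s' + lam_u - lam_u') * (\<Delta>u / (2 * \<delta>)) < 0"
    and estimator_times: "0 < \<delta>z" "0 < \<Delta>z" "\<delta>z \<le> \<delta>s" "\<Delta>u \<le> \<Delta>z"
      "- lam_s' + (lam_s' + lam_u') * (\<Delta>z / (\<delta>z + \<Delta>z)) < 0"
      "\<Delta>z * \<Delta>u / (2 * \<delta>) + \<delta>z * \<Delta>u / (2 * \<delta>) - \<Delta>z \<le> 0"
    and zeta: "\<And>t. 0 \<le> t \<Longrightarrow> \<zeta> t \<in> {0, 1}"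
      "\<And>(k::nat) t. t \<in> {k * (\<delta>z + \<Delta>z)<..k * (\<delta>z + \<Delta>z) + \<delta>z} \<Longrightarrow> \<zeta> t = 0"
      "\<And>(k::nat) t. t \<in> {k * (\<delta>z + \<Delta>z) + \<delta>z<..(k + 1) * (\<delta>z + \<Delta>z)} \<Longrightarrow> \<zeta> t = 1"
    and sigma: "\<sigma> \<in> restricted_admissible_signals PS PU E \<delta> \<Delta> \<delta>s \<Delta>u"
  shows "state_norm_estimator f h \<sigma>
           (\<lambda>t z (v :: real^'m) (y :: real^'k). estimator_field lam_s' lam_u' \<gamma>1 \<gamma>2 (\<zeta> t) z v y) {0..}"
proof -
  obtain \<tau> where si: "switching_instants \<sigma> \<tau>"
    and edge: "\<And>i. (\<sigma> (\<tau> i), \<sigma> (\<tau> (Suc i))) \<in> E" and mem: "\<And>i. \<sigma> (\<tau> i) \<in> PS \<union> PU"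
    and len: "\<And>i. \<delta> \<le> \<tau> (Suc i) - \<tau> i" "\<And>i. \<tau> (Suc i) - \<tau> i \<le> \<Delta>"
    and alt: "\<And>i. \<sigma> (\<tau> i) \<in> PU \<Longrightarrow> \<sigma> (\<tau> (Suc i)) \<notin> PU"
    and lenU: "\<And>i. \<sigma> (\<tau> i) \<in> PU \<Longrightarrow> \<tau> (Suc i) - \<tau> i \<le> \<Delta>u"
    using restricted_admissible_signals_cases[OF sigma] by blast
  have \<tau>: "time_grid \<tau>" using si by (rule switching_instants_time_grid)
  define \<tau>z where "\<tau>z = alternating_grid \<delta>z \<Delta>z"
  have \<tau>z: "time_grid \<tau>z"
    unfolding \<tau>z_def using estimator_times(1,2) by (rule alternating_grid_time_grid)
  define p where "p i = \<sigma> (\<tau> i)" for i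
  have p: "p i \<in> {1..N}" for i using mem partition by (auto simp: p_def)
  define \<phi> :: "nat \<Rightarrow> real" where "\<phi> i = of_bool (p i \<in> PU)" for i
  define \<psi> :: "nat \<Rightarrow> real" where "\<psi> n = of_bool (odd n)" for n
  define U where "U t = integral {0..t} (\<lambda>s. \<phi> (grid_index \<tau> s))" for t
  define Z where "Z t = integral {0..t} (\<lambda>s. \<psi> (grid_index \<tau>z s))" for t
  \<comment> \<open>The rate is \<open>- lam_s\<close> on stable and \<open>lam_u\<close> on
    unstable cells. Written affinely in the indicator, its integral depends on the activation time
    \<open>U\<close> alone, and likewise for \<open>\<rho>z\<close> and \<open>Z\<close>.\<close>
  define \<rho> where "\<rho> i = - lam_s + (lam_s + lam_u) * \<phi> i" for i
  define \<rho>z where "\<rho>z n = - lam_s' + (lam_s' + lam_u') * \<psi> n" for n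
  define A where "A t = integral {0..t} (\<lambda>s. \<rho> (grid_index \<tau> s)) + real (grid_index \<tau> t) * ln \<mu>" for t
  define R where "R t = integral {0..t} (\<lambda>s. \<rho>z (grid_index \<tau>z s))" for t
  have A: "A t = - lam_s * t + (lam_s + lam_u) * U t + real (grid_index \<tau> t) * ln \<mu>" if "0 \<le> t" for t
    unfolding A_def \<rho>_def U_def by (simp only: grid_integral_affine[OF \<tau> that])
  have R: "R t = - lam_s' * t + (lam_s' + lam_u') * Z t" if "0 \<le> t" for t
    unfolding R_def \<rho>z_def Z_def by (simp only: grid_integral_affine[OF \<tau>z that])
  define \<theta> \<theta>z where "\<theta> = \<Delta>u / (2 * \<delta>)" and "\<theta>z = \<Delta>z / (\<delta>z + \<Delta>z)"
  define C1 where "C1 = 2 * \<Delta>u + \<theta> * \<Delta>"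
  have Udrift: "U t - U s \<le> \<theta> * (t - s) + C1" if "0 \<le> s" "s \<le> t" for s t
    unfolding U_def C1_def \<theta>_def
    by (rule activation_time_le[OF \<tau>]) (use that len alt lenU dwell A4(2) in \<open>auto simp: \<phi>_def p_def\<close>)
  have Zdrift: "\<bar>Z t - \<theta>z * t\<bar> \<le> \<Delta>z" if "0 \<le> t" for t
    using alternating_activation_time[OF estimator_times(1,2) that]
    by (simp add: Z_def \<theta>z_def \<psi>_def \<tau>z_def)
  \<comment> \<open>This is the last condition on \<open>\<delta>z\<close> and
    \<open>\<Delta>z\<close>, divided by the period.\<close>
  have \<theta>_le: "\<theta> \<le> \<theta>z"
  proof -
    have "\<theta> * (\<delta>z + \<Delta>z) \<le> \<Delta>z"
      using estimator_times(6) by (simp add: \<theta>_def add_divide_distrib algebra_simps)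
    then show ?thesis using estimator_times(1,2) by (simp add: \<theta>z_def pos_le_divide_eq)
  qed
  have ln\<mu>: "0 \<le> ln \<mu>" using A2(1) by simp
  \<comment> \<open>Over a full period the estimator rate has the average
    \<open>- k\<close>.\<close>
  define k where "k = lam_s' - (lam_s' + lam_u') * \<theta>z"
  have k: "0 < k" using estimator_times(5) by (simp add: k_def \<theta>z_def)
  have lam: "0 < lam_s' + lam_u'" using rates A1(8) by simp
  define C2 where "C2 = (lam_s' + lam_u') * (2 * \<Delta>z)"
  have decay: "R t - R s \<le> C2 - k * (t - s)" if "0 \<le> s" "s \<le> t" for s t
  proof -
    have "Z t - Z s \<le> \<theta>z * (t - s) + 2 * \<Delta>z"
      using Zdrift[of s] Zdrift[of t] that by (simp add: right_diff_distrib abs_le_iff)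
    then have "(lam_s' + lam_u') * (Z t - Z s) \<le> (lam_s' + lam_u') * (\<theta>z * (t - s) + 2 * \<Delta>z)"
      using lam by (intro mult_left_mono) auto
    then show ?thesis using that by (simp add: R k_def C2_def algebra_simps)
  qed
  \<comment> \<open>In the constant of \<open>drift_rate_estimate\<close>, the error of
    \<open>Z\<close> is \<open>2 * \<Delta>z\<close>, one \<open>\<Delta>z\<close> for each end of
    the interval; \<open>C2\<close> above is this error times the jump of the estimator rate between
    its modes.\<close>
  define C where "C = (lam_s - lam_s' + lam_u - lam_u') * C1 + (lam_s' + lam_u') * (C1 + 2 * \<Delta>z) + ln \<mu>"
  have drift: "A t - A s \<le> R t - R s + C" if st: "0 \<le> s" "s \<le> t" for s t
  proof -
    have "- lam_s * (t - s) + (lam_s + lam_u) * (U t - U s)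
          + (real (grid_index \<tau> t) - real (grid_index \<tau> s)) * ln \<mu>
        \<le> - lam_s' * (t - s) + (lam_s' + lam_u') * (Z t - Z s) + C"
      unfolding C_def
    proof (rule drift_rate_estimate[where \<theta> = \<theta> and \<theta>z = \<theta>z and \<delta> = \<delta>])
      show "U t - U s \<le> \<theta> * (t - s) + C1" using st by (rule Udrift)
      show "\<theta>z * (t - s) - 2 * \<Delta>z \<le> Z t - Z s"
        using Zdrift[of s] Zdrift[of t] st by (simp add: right_diff_distrib abs_le_iff)
      show "real (grid_index \<tau> t) - real (grid_index \<tau> s) \<le> (t - s) / \<delta> + 1"
        using \<tau> dwell(1) len(1) st by (rule grid_index_diff_le)
      show "ln \<mu> * (1 / \<delta>) - (lam_s - lam_s') + (lam_s - lam_s' + lam_u - lam_u') * \<theta> \<le> 0"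
        using rates(6) by (simp add: \<theta>_def)
    qed (use st \<theta>_le ln\<mu> lam rates in auto)
    then show ?thesis using st by (simp add: A R algebra_simps)
  qed
  have A0: "A 0 = 0" and R0: "R 0 = 0"
  proof -
    have "grid_index \<tau> 0 = 0"
      using len(1)[of 0] dwell si by (intro grid_index_eq[OF \<tau>]) (auto simp: switching_instants_def)
    then show "A 0 = 0" by (simp add: A_def)
    show "R 0 = 0" by (simp add: R_def)
  qed
  let ?G = "\<lambda>t z (v :: real^'m) (y :: real^'k). estimator_field lam_s' lam_u' \<gamma>1 \<gamma>2 (\<zeta> t) z v y"
  have G: "?G s z v y = \<rho>z (grid_index \<tau>z s) * z + (\<gamma>1 (norm v) + \<gamma>2 (norm y))"
    if "0 \<le> s" "s \<notin> range \<tau>z" for s z v y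
    unfolding \<rho>z_def \<psi>_def \<tau>z_def
    by (rule estimator_field_grid[OF estimator_times(1,2) zeta(2,3)]) (use that in \<open>auto simp: \<tau>z_def\<close>)
  have negl: "negligible (range \<tau>z)"
    by (simp add: negligible_iff_null_sets null_sets_completionI countable_imp_null_set_lborel)
  note K = class_Kinf_class_K[OF A1(3)] class_Kinf_class_K[OF A1(4)]
  have iss: "iss_wrt_input_output ?G {0..}"
    using \<tau>z A1(3,4) negl G k decay unfolding R_def by (rule grid_linear_iss)
  obtain \<alpha>i where \<alpha>i: "class_Kinf \<alpha>i" "\<And>r. 0 \<le> r \<Longrightarrow> \<alpha>i (\<alpha>1 r) = r"
    using class_Kinf_inverse[OF A1(1)] by metis
  \<comment> \<open>The factor \<open>exp C\<close> comes from comparing the drifts,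
    \<open>exp C2\<close> from the decay of \<open>R\<close>, and 2 from splitting the argument of
    \<open>\<alpha>i\<close> into two terms.\<close>
  define \<beta> where "\<beta> r t = \<alpha>i (2 * exp (C + C2) * exp (- k * t) * \<alpha>2 r)" for r t
  define \<eta> where "\<eta> r = \<alpha>i (2 * exp C * r)" for r
  have \<beta>: "class_KL \<beta>"
    unfolding \<beta>_def using class_Kinf_class_K[OF \<alpha>i(1)] class_Kinf_class_K[OF A1(2)] k
    by (intro class_KL_exp_decay) auto
  have \<eta>: "class_Kinf \<eta>"
    unfolding \<eta>_def using \<alpha>i(1) by (intro class_Kinf_compose_scale) auto
  have estimate: "norm (x t) \<le> \<beta> (norm x0 + norm z0) t + \<eta> (norm (z t))"
    if z0: "z0 \<in> {0..}" and x: "caratheodory_solution T (\<lambda>s \<xi>. f (\<sigma> s) \<xi> (v s)) x0 x"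
      and z: "caratheodory_solution T (\<lambda>s \<xi>. ?G s \<xi> (v s) (h (\<sigma> s) (x s))) z0 z"
      and t: "0 \<le> t" "ereal t < T"
    for x0 z0 v T x z t
  proof -
    define u where "u s = \<gamma>1 (norm (v s)) + \<gamma>2 (norm (h (\<sigma> s) (x s)))" for s
    have u0: "0 \<le> u s" for s
      using class_K_nonneg[OF K(1)] class_K_nonneg[OF K(2)] by (simp add: u_def)
    have Rp: "primitive_on 0 t (\<lambda>s. \<rho>z (grid_index \<tau>z s)) R"
      unfolding R_def by (rule primitive_on_grid_function[OF \<tau>z])
    have zp: "primitive_on 0 t (\<lambda>s. \<rho>z (grid_index \<tau>z s) * z s + u s) z"
      using caratheodory_solution_primitive_on(1)[OF z t] negl
      by (rule primitive_on_spike) (simp add: G u_def)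
    have u: "u absolutely_integrable_on {0..t}"
      using zp grid_function_absolutely_integrable[OF \<tau>z] by (rule linear_ode_integrable_input)
    define I where "I = integral {0..t} (\<lambda>s. exp (- R s) * u s)"
    have I_int: "(\<lambda>s. exp (- R s) * u s) integrable_on {0..t}"
      using continuous_times_absolutely_integrable[OF _ u, of "\<lambda>s. exp (- R s)"]
        primitive_on_continuous[OF Rp]
      by (simp add: absolutely_integrable_on_def continuous_on_exp continuous_on_minus)
    have I0: "0 \<le> I" unfolding I_def using I_int u0 by (intro integral_nonneg) auto
    have "exp (- R t) * z t = z0 + I"
      using linear_ode_solution[OF zp Rp t(1)] R0 caratheodory_solution_primitive_on(2)[OF z t]
      by (simp add: I_def)
    then have zt: "z t = exp (R t) * z0 + exp (R t) * I"
      by (simp add: exp_minus field_simps)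
    have xp: "primitive_on 0 t (\<lambda>s. f (\<sigma> s) (x s) (v s)) x" and x0: "x 0 = x0"
      using caratheodory_solution_primitive_on[OF x t] by auto
    have \<sigma>: "\<sigma> s = p (grid_index \<tau> s)" if "0 \<le> s" for s
      unfolding p_def using si that by (rule switching_instants_value)
    have le: "frechet_derivative (V (p (grid_index \<tau> s))) (at (x s)) (f (\<sigma> s) (x s) (v s))
        \<le> \<rho> (grid_index \<tau> s) * V (p (grid_index \<tau> s)) (x s) + u s" if "s \<in> {0..t}" for s
    proof (cases "\<sigma> s \<in> PU")
      case True
      then show ?thesis
        using A1(11)[OF True, of "x s" "v s"] \<sigma>[of s] that by (simp add: \<rho>_def \<phi>_def u_def)
    next
      case False
      then have PS: "\<sigma> s \<in> PS" using mem[of "grid_index \<tau> s"] \<sigma>[of s] that by (auto simp: p_def)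
      show ?thesis
        using A1(10)[OF PS, of "x s" "v s"] False \<sigma>[of s] that by (simp add: \<rho>_def \<phi>_def u_def)
    qed
    have jump: "V (p (Suc i)) \<xi> \<le> \<mu> * V (p i) \<xi>" for i \<xi>
      unfolding p_def using edge by (rule A2(2))
    have \<mu>: "0 < \<mu>" using A2(1) by simp
    note comparison = switched_lyapunov_comparison[where V = "\<lambda>i. V (p i)" and \<rho> = \<rho>,
        OF \<tau> xp t(1) A1(5)[OF p] \<mu> le jump u, folded A_def]
    have "V (p (grid_index \<tau> t)) (x t) \<le> exp C * exp (R t) * (V (p 0) x0 + I)"
      unfolding I_def
    proof (rule drift_comparison[where A = A and R = R, OF t(1) _ A0 R0])
      show "A t - A s \<le> R t - R s + C" if "s \<in> {0..t}" for s
        using drift that by auto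
      show "(\<lambda>s. exp (- A s) * u s) integrable_on {0..t}"
        using comparison(1) by (simp add: absolutely_integrable_on_def)
      show "0 \<le> V (p 0) x0" using p by (rule A1(6))
      show "exp (- A t) * V (p (grid_index \<tau> t)) (x t)
          \<le> V (p 0) x0 + integral {0..t} (\<lambda>s. exp (- A s) * u s)"
        using comparison(2) by (simp add: x0)
    qed (use I_int u0 in auto)
    also have "\<dots> = exp C * (exp (R t) * V (p 0) x0) + exp C * (exp (R t) * I)"
      by (simp add: distrib_left mult.assoc)
    also have "\<dots> \<le> exp C * (exp (C2 - k * t) * \<alpha>2 (norm x0 + norm z0)) + exp C * z t"
    proof (intro add_mono mult_left_mono mult_mono)
      show "exp (R t) \<le> exp (C2 - k * t)"
        using decay[of 0 t] t(1) R0 by simp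
      have "V (p 0) x0 \<le> \<alpha>2 (norm x0)" using A1(9)[OF p] by blast
      also have "\<dots> \<le> \<alpha>2 (norm x0 + norm z0)"
        using class_Kinf_class_K[OF A1(2)] by (rule class_K_mono) auto
      finally show "V (p 0) x0 \<le> \<alpha>2 (norm x0 + norm z0)" .
      \<comment> \<open>The point where the estimator state replaces the inputs: \<open>z t\<close>
        exceeds the integral term by \<open>exp (R t) * z0\<close>, which is nonnegative.\<close>
      show "exp (R t) * I \<le> z t" using z0 by (simp add: zt)
    qed (use A1(6)[OF p] in auto)
    also have "exp C * (exp (C2 - k * t) * \<alpha>2 (norm x0 + norm z0))
        = exp (C + C2) * exp (- k * t) * \<alpha>2 (norm x0 + norm z0)"
      by (simp add: exp_add exp_diff exp_minus divide_inverse)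
    finally have "\<alpha>1 (norm (x t))
        \<le> exp (C + C2) * exp (- k * t) * \<alpha>2 (norm x0 + norm z0) + exp C * z t"
      using A1(9)[OF p, of "x t" "grid_index \<tau> t"] by linarith
    moreover have zt0: "0 \<le> z t" using z0 I0 by (simp add: zt)
    moreover have "0 \<le> \<alpha>2 (norm x0 + norm z0)"
      using class_Kinf_class_K[OF A1(2)] by (rule class_K_nonneg) simp
    ultimately have "norm (x t) \<le> \<alpha>i (2 * (exp (C + C2) * exp (- k * t) * \<alpha>2 (norm x0 + norm z0)))
        + \<alpha>i (2 * (exp C * z t))"
      using class_Kinf_class_K[OF A1(1)] class_Kinf_class_K[OF \<alpha>i(1)] \<alpha>i(2)
      by (intro class_Kinf_inverse_le_add) auto
    then show ?thesis using zt0 by (simp add: \<beta>_def \<eta>_def mult.assoc)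
  qed
  show ?thesis
    unfolding state_norm_estimator_def using iss \<beta> \<eta> estimate by blast
qed

end
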